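(* The set $$\mathcal S=\{n\in\mathbb Z_{>0}: S_r(n)\in\mathbb Z \text{ for some integer } r\ge 1\}$$ has zero (asymptotic) density as a subset of the integers, i.e. $\lim_{x\to\infty}\frac{1}{x}\#(\mathcal S\cap[1,x])=0$.
   Context: For positive integers $r,n$, $S_r(n)$ denotes the rational number $$S_r(n)=\sum_{k=1}^{n}\frac{k}{k+r}\binom{n}{k}.$$ *)

theory Defs
  imports Complex_Main
begin

definition S :: "nat \<Rightarrow> nat \<Rightarrow> rat" where
  "S r n = (\<Sum>k=1..n. of_nat k / of_nat (k + r) * of_nat (n choose k))"

definition integral_set :: "nat set" where
  "integral_set = {n. n > 0 \<and> (\<exists>r\<ge>1. S r n \<in> \<int>)}"

end

theory Submission
  imports Defs "HOL-Computational_Algebra.Squarefree" "HOL-Number_Theory.Pocklington"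
    "HOL-Real_Asymp.Real_Asymp"
begin

text \<open>
  Writing \<open>k/(k+r) = 1 - r/(k+r)\<close> and evaluating \<open>\<integral>\<^sub>0\<^sup>1 t\<^sup>r\<^sup>-\<^sup>1 (1+t)\<^sup>n dt\<close> in two ways, integrality of
  \<open>S r n\<close> forces every prime \<open>p > r\<close> dividing some \<open>m \<in> {n<..n+r}\<close> to divide \<open>2\<^sup>m - 1\<close>, hence
  \<open>p * ord p 2 dvd m\<close>. Integers \<open>m\<close> with such a prime \<open>p > y\<close> have density tending to \<open>0\<close> like a
  power of \<open>1/y\<close>, because few primes have small order. On the other hand, comparing the size of
  \<open>n+r choose r\<close> with the contribution of its primes \<open>\<le> r\<close> shows, in the manner of Sylvester and
  Erdos, that many elements of \<open>{n<..n+r}\<close> have a prime factor exceeding \<open>r\<close>. Markov's inequality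
  on the scales \<open>8\<^sup>i \<le> r < 8\<^sup>i\<^sup>+\<^sup>1\<close> makes the two facts incompatible for almost all \<open>n\<close>. Bounded \<open>r\<close>
  need only \<open>m = n+1\<close>, since \<open>y\<close>-smooth numbers have density \<open>0\<close>. If \<open>n/2 < r \<le> n\<close> one such prime
  suffices, as then \<open>p * ord p 2 > n + r\<close>; and if \<open>r > n\<close>, a prime \<open>p > n\<close> dividing some
  \<open>k + r\<close> with \<open>1 \<le> k \<le> n\<close> divides exactly one denominator and not its numerator.
\<close>

section \<open>Integrality and orders\<close>

text \<open>After clearing the denominators prime to \<open>p\<close>, integrality leaves
  \<open>a i * D = b i * (z * D - w)\<close>. Here \<open>D\<close> is prime to \<open>p\<close>, so
  a \<open>p\<close> in the only denominator containing it must be cancelled by its own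
  numerator.\<close>

lemma dvd_numerator_if_sum_fractions_int:
  fixes a b :: "'i \<Rightarrow> int"
  assumes I: "finite I" "i \<in> I" and p: "prime p" "p dvd b i"
    and nd: "\<And>j. j \<in> I - {i} \<Longrightarrow> \<not> p dvd b j"
    and b: "b i \<noteq> 0"
    and int: "(\<Sum>j\<in>I. of_int (a j) / of_int (b j) :: rat) \<in> \<int>"
  shows "p dvd a i"
proof -
  define D where "D = (\<Prod>j\<in>I-{i}. b j)"
  define w where "w = (\<Sum>j\<in>I-{i}. a j * (\<Prod>k\<in>I-{i}-{j}. b k))"
  obtain z :: int where z: "(\<Sum>j\<in>I. of_int (a j) / of_int (b j) :: rat) = of_int z"
    using int by (auto elim: Ints_cases)
  have nD: "\<not> p dvd D"
    using I nd p unfolding D_def by (subst prime_dvd_prod_iff) auto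
  have "of_int (a j) / of_int (b j) * of_int D = (of_int (a j * (\<Prod>k\<in>I-{i}-{j}. b k)) :: rat)"
    if j: "j \<in> I - {i}" for j
  proof -
    have "D = b j * (\<Prod>k\<in>I-{i}-{j}. b k)"
      unfolding D_def using I j by (subst prod.remove[of _ j]) auto
    moreover have "b j \<noteq> 0" using nd[OF j] by auto
    ultimately show ?thesis by simp
  qed
  then have w: "(\<Sum>j\<in>I-{i}. of_int (a j) / of_int (b j)) * of_int D = (of_int w :: rat)"
    unfolding w_def of_int_sum sum_distrib_right by (intro sum.cong) auto
  have "(of_int (a i) / of_int (b i) + (\<Sum>j\<in>I-{i}. of_int (a j) / of_int (b j))) * of_int D
      = (of_int z * of_int D :: rat)"
    using z I by (subst (asm) sum.remove[of _ i]) auto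
  then have "of_int (a i) / of_int (b i) * of_int D + of_int w = (of_int z * of_int D :: rat)"
    using w by (simp add: algebra_simps)
  then have "(of_int (a i * D) :: rat) = of_int (b i * (z * D - w))"
    using b by (simp add: field_simps)
  then have "a i * D = b i * (z * D - w)"
    by (simp only: of_int_eq_iff)
  then have "p dvd a i * D" using p by simp
  then show ?thesis using nD p prime_dvd_mult_iff by blast
qed

text \<open>Both sides are \<open>\<integral>\<^sub>0\<^sup>1 t\<^sup>q (1 + t)\<^sup>n dt\<close>.\<close>
lemma sum_choose_div_eq:
  "(\<Sum>k\<le>n. real (n choose k) / real (k + q + 1))
   = (\<Sum>j\<le>q. (- 1) ^ (q - j) * real (q choose j) * (2 ^ (n + j + 1) - 1) / real (n + j + 1))"
proof -
  \<comment> \<open>No integral is formed: \<open>F\<close> is the difference of the antiderivatives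
    of the two expansions of x^q (1 + x)^n, both normalised to vanish at 0. The \<open>- 1\<close>
    in the second sum is this normalisation.\<close>
  define F where "F x = (\<Sum>k\<le>n. real (n choose k) * (x ^ (k + q + 1) / real (k + q + 1)))
    - (\<Sum>j\<le>q. (- 1) ^ (q - j) * real (q choose j) * (((1 + x) ^ (n + j + 1) - 1) / real (n + j + 1)))" for x
  have 1: "((\<lambda>x. x ^ (k + q + 1) / real (k + q + 1)) has_real_derivative x ^ (k + q)) (at x)" for k x
    by (rule derivative_eq_intros refl | simp)+
  have 2: "((\<lambda>x. ((1 + x) ^ (n + j + 1) - 1) / real (n + j + 1)) has_real_derivative (1 + x) ^ (n + j)) (at x)" for j x
    by (rule derivative_eq_intros refl | simp)+
  have "(F has_real_derivative 0) (at x)" for x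
  proof -
    have "(F has_real_derivative ((\<Sum>k\<le>n. real (n choose k) * x ^ (k + q))
      - (\<Sum>j\<le>q. (- 1) ^ (q - j) * real (q choose j) * (1 + x) ^ (n + j)))) (at x)"
      unfolding F_def by (intro DERIV_diff DERIV_sum DERIV_cmult 1 2)
    moreover have "(\<Sum>k\<le>n. real (n choose k) * x ^ (k + q)) = x ^ q * (x + 1) ^ n"
      by (subst binomial_ring) (simp add: sum_distrib_left power_add algebra_simps)
    moreover have "(\<Sum>j\<le>q. (- 1) ^ (q - j) * real (q choose j) * (1 + x) ^ (n + j))
        = (1 + x) ^ n * ((1 + x) + (- 1)) ^ q"
      by (subst binomial_ring[of "1 + x"]) (simp add: sum_distrib_left power_add algebra_simps)
    ultimately show ?thesis by (simp add: algebra_simps)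
  qed
  then have "F 1 = F 0" by (metis DERIV_isconst_all)
  then show ?thesis by (simp add: F_def)
qed

text \<open>Trades the denominators \<open>k + r\<close> for the elements of
  \<open>{n<..n + r}\<close>, where each numerator carries a factor \<open>2 ^ m - 1\<close> for its
  denominator \<open>m\<close>.\<close>

lemma S_eq:
  "S (Suc q) n = 2 ^ n - of_nat (Suc q) *
     (\<Sum>j\<le>q. (- 1) ^ (q - j) * of_nat (q choose j) * (2 ^ (n + j + 1) - 1) / of_nat (n + j + 1))"
proof -
  have "S (Suc q) n = (\<Sum>k\<le>n. of_nat k / of_nat (k + Suc q) * of_nat (n choose k))"
    unfolding S_def by (rule sum.mono_neutral_left) (auto simp: not_le)
  also have "\<dots> = (\<Sum>k\<le>n. of_nat (n choose k) - of_nat (Suc q) * (of_nat (n choose k) / of_nat (k + q + 1)))"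
    by (intro sum.cong refl) (simp add: field_simps del: of_nat_Suc of_nat_add, simp add: algebra_simps)
  also have "\<dots> = of_nat (\<Sum>k\<le>n. n choose k) - of_nat (Suc q) * (\<Sum>k\<le>n. of_nat (n choose k) / of_nat (k + q + 1))"
    by (simp add: sum_subtractf sum_distrib_left)
  also have "of_nat (\<Sum>k\<le>n. n choose k) = (2 ^ n :: rat)"
    by (simp add: choose_row_sum)
  also have "(\<Sum>k\<le>n. of_nat (n choose k) / of_nat (k + q + 1)) =
    (\<Sum>j\<le>q. (- 1) ^ (q - j) * of_nat (q choose j) * (2 ^ (n + j + 1) - 1) / (of_nat (n + j + 1) :: rat))"
    (is "?A = ?B")
  proof -
    have "of_rat ?A = (of_rat ?B :: real)"
      using sum_choose_div_eq[of n q]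
      by (simp add: of_rat_sum of_rat_divide of_rat_mult of_rat_diff of_rat_power of_rat_add of_rat_minus)
    then show ?thesis by simp
  qed
  finally show ?thesis .
qed

lemma multiple_in_interval_unique:
  fixes p m m' :: nat
  assumes "p dvd m" "p dvd m'" "m \<in> {b<..b + a}" "m' \<in> {b<..b + a}" "a < p"
  shows "m = m'"
proof -
  have "int p dvd int m - int m'" using assms by (simp add: dvd_diff)
  moreover have "\<bar>int m - int m'\<bar> < int p" using assms by auto
  ultimately have "int m - int m' = 0"
    by (metis abs_of_nat dvd_imp_le_int linorder_not_less)
  then show ?thesis by simp
qed

text \<open>In \<open>S_eq\<close> only the denominator \<open>m\<close> is divisible by
  \<open>p\<close>, as an interval of length \<open>r < p\<close> holds at most one multiple. The
  other factors of its numerator, namely \<open>r\<close>, the sign and \<open>q choose i\<close>,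
  are prime to \<open>p\<close>.\<close>

lemma dvd_two_power_if_S_int:
  assumes int: "S r n \<in> \<int>" and r: "r \<ge> 1" and p: "prime p" "p > r"
    and m: "m \<in> {n<..n + r}" "p dvd m"
  shows "p dvd 2 ^ m - 1"
proof -
  obtain q where q: "r = Suc q" using r by (cases r) auto
  define a :: "nat \<Rightarrow> int" where
    "a j = int r * (- 1) ^ (q - j) * int (q choose j) * (2 ^ (n + j + 1) - 1)" for j
  define b :: "nat \<Rightarrow> int" where "b j = int (n + j + 1)" for j
  define i where "i = m - n - 1"
  have i: "i \<le> q" "n + i + 1 = m" using m q by (auto simp: i_def)
  have "(\<Sum>j\<le>q. of_int (a j) / of_int (b j)) = 2 ^ n - S r n"
    unfolding a_def b_def q S_eq by (simp add: sum_distrib_left mult.assoc)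
  also have "\<dots> \<in> \<int>" using int by auto
  finally have "int p dvd a i"
  proof (rule dvd_numerator_if_sum_fractions_int[rotated -1])
    show "int p dvd b i" using i m unfolding b_def by (metis int_dvd_int_iff)
    show "\<not> int p dvd b j" if j: "j \<in> {..q} - {i}" for j
    proof
      assume "int p dvd b j"
      then have "p dvd n + j + 1" unfolding b_def by (metis int_dvd_int_iff)
      then have "n + j + 1 = m"
        using j q by (intro multiple_in_interval_unique[OF _ m(2) _ m(1) p(2)]) auto
      then show False using i j by auto
    qed
  qed (use p i in \<open>auto simp: b_def\<close>)
  moreover have "\<not> int p dvd int r" using p r by (auto dest: zdvd_imp_le)
  moreover have "\<not> p dvd (q choose i)"
  proof
    assume "p dvd (q choose i)"
    then have "p dvd fact q"
      using i binomial_fact_lemma[of i q] by (metis dvd_mult)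
    then show False using p q by (simp add: prime_dvd_fact_iff)
  qed
  moreover have "\<not> int p dvd (- 1) ^ (q - i)"
    using p by (metis abs_minus abs_1 dvd_abs_iff int_dvd_int_iff minus_one_power_iff not_prime_unit of_nat_1)
  moreover have pp: "prime (int p)" using p by simp
  ultimately have "int p dvd 2 ^ m - 1"
    unfolding a_def i prime_dvd_mult_iff[OF pp] int_dvd_int_iff
    by blast
  also have "2 ^ m - 1 = int (2 ^ m - 1)" by (simp add: of_nat_diff)
  finally show ?thesis by (simp only: int_dvd_int_iff)
qed

text \<open>Works with the defining sum itself and disposes of \<open>r > n\<close>: the numerator
  \<open>k * (n choose k)\<close> has only prime factors up to \<open>n\<close>.\<close>

lemma S_not_int:
  assumes p: "prime p" "p > n" and m: "m \<in> {r<..r + n}" "p dvd m"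
  shows "S r n \<notin> \<int>"
proof
  assume int: "S r n \<in> \<int>"
  define a :: "nat \<Rightarrow> int" where "a k = int (k * (n choose k))" for k
  define b :: "nat \<Rightarrow> int" where "b k = int (k + r)" for k
  define i where "i = m - r"
  have i: "i \<in> {1..n}" "i + r = m" using m by (auto simp: i_def)
  have "(\<Sum>k=1..n. of_int (a k) / of_int (b k) :: rat) \<in> \<int>"
    using int unfolding a_def b_def S_def by simp
  then have "int p dvd a i"
  proof (rule dvd_numerator_if_sum_fractions_int[rotated -1])
    show "int p dvd b i" using i m unfolding b_def by (metis int_dvd_int_iff)
    show "\<not> int p dvd b j" if j: "j \<in> {1..n} - {i}" for j
    proof
      assume "int p dvd b j"
      then have "p dvd j + r" unfolding b_def by (metis int_dvd_int_iff)
      then have "j + r = m"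
        using j by (intro multiple_in_interval_unique[OF _ m(2) _ m(1) p(2)]) auto
      then show False using i j by auto
    qed
  qed (use p i in \<open>auto simp: b_def\<close>)
  then have "p dvd i * (n choose i)" unfolding a_def by (simp only: int_dvd_int_iff)
  moreover have "\<not> p dvd i" using p i by (auto dest: dvd_imp_le)
  moreover have "\<not> p dvd (n choose i)"
  proof
    assume "p dvd (n choose i)"
    then have "p dvd fact n"
      using i binomial_fact_lemma[of i n] by (metis atLeastAtMost_iff dvd_mult)
    then show False using p by (simp add: prime_dvd_fact_iff)
  qed
  ultimately show False using p by (simp add: prime_dvd_mult_iff)
qed

lemma coprime_two_if_dvd_two_power:
  assumes "(p::nat) dvd 2 ^ m - 1" "m > 0"
  shows "coprime p 2"
proof -
  have "odd (2 ^ m - 1 :: nat)" using assms(2) by simp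
  then have "odd p" using assms(1) dvd_trans by blast
  then show ?thesis by simp
qed

text \<open>Both \<open>p\<close> and the order divide \<open>m\<close>, and they are coprime
  because the order divides \<open>p - 1\<close>.\<close>

lemma prime_times_ord_dvd:
  assumes p: "prime p" "p dvd m" "p dvd 2 ^ m - 1" and m: "m > 0"
  shows "p * ord p (2::nat) dvd m"
proof -
  have "[2 ^ m = 1] (mod p)"
    using p(3) by (subst cong_altdef_nat) auto
  then have o: "ord p 2 dvd m" using ord_divides[of 2 m p] by blast
  have c: "coprime p 2" using coprime_two_if_dvd_two_power p m by blast
  then have "ord p 2 dvd totient p" using order_divides_totient by blast
  then have "ord p 2 dvd p - 1" using p by (simp add: totient_prime)
  moreover have "0 < p - 1" using p(1) prime_gt_1_nat[of p] by simp
  ultimately have "ord p 2 < p" by (metis dvd_imp_le less_le_trans diff_less le_less_trans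
    prime_gt_0_nat[OF p(1)] zero_less_one)
  then have "\<not> p dvd ord p 2" using c by (meson nat_dvd_not_less ord_gt_0_iff)
  then have "coprime p (ord p 2)" using p(1) by (simp add: prime_imp_coprime)
  then show ?thesis using o p divides_mult by blast
qed

section \<open>Prime factors of binomial coefficients\<close>

lemma Suc_div_eq: "d > 0 \<Longrightarrow> Suc n div d = n div d + (if d dvd Suc n then 1 else 0)"
  by (simp add: div_Suc dvd_eq_mod_eq_0)

lemma multiplicity_eq_sum:
  assumes p: "prime (p::nat)" and m: "m > 0" "m < p ^ k"
  shows "multiplicity p m = (\<Sum>i\<in>{1..<k}. if p ^ i dvd m then 1 else 0)"
proof -
  have "multiplicity p m < k"
    using m multiplicity_dvd[of p m] p
    by (metis dvd_imp_le le_less_trans power_less_imp_less_exp prime_gt_1_nat)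
  have "(\<Sum>i\<in>{1..<k}. if p ^ i dvd m then 1 else 0) = card {i \<in> {1..<k}. p ^ i dvd m}"
    by (simp add: sum.If_cases Int_def)
  also have "{i \<in> {1..<k}. p ^ i dvd m} = {1..multiplicity p m}"
    using \<open>multiplicity p m < k\<close> p m by (auto simp: power_dvd_iff_le_multiplicity not_prime_unit
      intro: multiplicity_dvd' intro!: multiplicity_geI)
  finally show ?thesis by simp
qed

text \<open>Legendre's formula: passing to \<open>Suc n\<close> raises exactly those summands with
  \<open>p ^ i dvd Suc n\<close>. The cut-off \<open>k\<close> is free, so that the three factorials
  of a binomial coefficient can share one range of summation.\<close>

lemma multiplicity_fact_eq_sum:
  assumes p: "prime (p::nat)"
  shows "n < p ^ k \<Longrightarrow> multiplicity p (fact n :: nat) = (\<Sum>i\<in>{1..<k}. n div p ^ i)"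
proof (induction n)
  case (Suc n)
  have "multiplicity p (fact (Suc n) :: nat) = multiplicity p (Suc n) + multiplicity p (fact n :: nat)"
    using p by (simp add: prime_elem_multiplicity_mult_distrib del: mult_Suc)
  also have "\<dots> = (\<Sum>i\<in>{1..<k}. if p ^ i dvd Suc n then 1 else 0) + (\<Sum>i\<in>{1..<k}. n div p ^ i)"
    using Suc p multiplicity_eq_sum[of p "Suc n" k] by simp
  also have "\<dots> = (\<Sum>i\<in>{1..<k}. Suc n div p ^ i)"
    using p by (subst sum.distrib[symmetric], intro sum.cong refl)
      (subst Suc_div_eq, auto simp: prime_gt_0_nat)
  finally show ?case .
qed auto

lemma multiplicity_choose_eq_sum:
  assumes p: "prime (p::nat)" and N: "a + b < p ^ k"
  shows "int (multiplicity p ((a + b) choose a))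
    = (\<Sum>i\<in>{1..<k}. int ((a + b) div p ^ i) - int (a div p ^ i) - int (b div p ^ i))"
proof -
  have "fact a * fact b * ((a + b) choose a) = (fact (a + b) :: nat)"
    using binomial_fact_lemma[of a "a + b"] by simp
  then have "multiplicity p (fact (a + b) :: nat)
    = multiplicity p (fact a :: nat) + multiplicity p (fact b :: nat) + multiplicity p ((a + b) choose a)"
    using p by (metis (no_types, lifting) binomial_eq_0_iff fact_nonzero le_add1 mult_eq_0_iff not_le
        prime_elem_multiplicity_mult_distrib prime_imp_prime_elem)
  then have "int (multiplicity p ((a + b) choose a)) = int (multiplicity p (fact (a + b) :: nat))
    - int (multiplicity p (fact a :: nat)) - int (multiplicity p (fact b :: nat))"
    by simp
  also have "\<dots> = int (\<Sum>i\<in>{1..<k}. (a + b) div p ^ i) - int (\<Sum>i\<in>{1..<k}. a div p ^ i)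
     - int (\<Sum>i\<in>{1..<k}. b div p ^ i)"
    using N by (simp add: multiplicity_fact_eq_sum[OF p, of _ k])
  finally show ?thesis by (simp add: sum_subtractf)
qed

lemma div_add_le_Suc: "(a + b) div d \<le> a div d + b div d + (1::nat)"
proof (cases "d = 0")
  case False
  then have "a mod d + b mod d < 2 * d"
    using mod_less_divisor[of d a] mod_less_divisor[of d b] by linarith
  then have "(a mod d + b mod d) div d \<le> 1"
    using False by (simp add: less_mult_imp_div_less less_Suc_eq_le[symmetric])
  then show ?thesis by (simp add: div_add1_eq[of a b d])
qed simp

text \<open>Each summand of Legendre's formula for the binomial coefficient is at most 1, and only
  the \<open>i\<close> with \<open>p ^ i \<le> a + b\<close> are summed.\<close>

lemma prime_power_multiplicity_choose_le:
  assumes p: "prime (p::nat)" and pos: "a + b > 0"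
  shows "p ^ multiplicity p ((a + b) choose a) \<le> a + b"
proof -
  define l where "l = (LEAST k. a + b < p ^ k)"
  have "\<exists>k. a + b < p ^ k" using p by (metis less_exp less_le_trans power_mono prime_ge_2_nat zero_le)
  then have l: "a + b < p ^ l" unfolding l_def by (rule LeastI_ex)
  then obtain k where k: "l = Suc k" using pos by (cases l) auto
  have le: "p ^ k \<le> a + b"
    using not_less_Least[of k "\<lambda>k. a + b < p ^ k"] k unfolding l_def by auto
  have "int (multiplicity p ((a + b) choose a)) \<le> (\<Sum>i\<in>{1..<l}. 1)"
    unfolding multiplicity_choose_eq_sum[OF p l]
    by (intro sum_mono) (use div_add_le_Suc in \<open>smt (verit) of_nat_1 of_nat_add of_nat_mono\<close>)
  then have "multiplicity p ((a + b) choose a) \<le> k" using k by simp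
  then have "p ^ multiplicity p ((a + b) choose a) \<le> p ^ k"
    using p by (intro power_increasing) (auto simp: prime_ge_Suc_0_nat)
  then show ?thesis using le by simp
qed

lemma multiplicity_choose_le_1:
  assumes p: "prime (p::nat)" and "a + b < p ^ 2" and pos: "a + b > 0"
  shows "multiplicity p ((a + b) choose a) \<le> 1"
proof -
  have "p ^ multiplicity p ((a + b) choose a) < p ^ 2"
    using prime_power_multiplicity_choose_le[OF p pos] assms by simp
  then have "multiplicity p ((a + b) choose a) < 2"
    using p power_less_imp_less_exp prime_gt_1_nat by blast
  then show ?thesis by simp
qed

text \<open>Erdos's observation from the proof of Bertrand's postulate: only \<open>i = 1\<close>
  occurs, and there \<open>(a + b) div p\<close> is at most 2 while \<open>a div p\<close> and
  \<open>b div p\<close> already account for 2.\<close>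

lemma multiplicity_choose_eq_0:
  assumes p: "prime (p::nat)" and "p \<le> a" "a \<le> b" "a + b < 3 * p" "3 \<le> p"
  shows "multiplicity p ((a + b) choose a) = 0"
proof -
  have "3 * p \<le> p * p" using assms(5) by (intro mult_right_mono) auto
  then have "a + b < p ^ 2" using assms(4) unfolding power2_eq_square by linarith
  from multiplicity_choose_eq_sum[OF p this]
  have "int (multiplicity p ((a + b) choose a)) = int ((a + b) div p) - int (a div p) - int (b div p)"
    by (simp add: numeral_2_eq_2)
  moreover have "(a + b) div p \<le> 2" using assms by (simp add: less_mult_imp_div_less less_Suc_eq_le[symmetric])
  moreover have "a div p \<ge> 1" "b div p \<ge> 1"
    using assms p by (auto simp: Suc_le_eq div_greater_zero_iff prime_gt_0_nat)
  ultimately show ?thesis by linarith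
qed

section \<open>Chebyshev-type bounds for the product and the number of primes\<close>

lemma prime_dvd_choose_odd:
  assumes "prime p" "p \<in> {m + 1<..2 * m + 1}"
  shows "p dvd (2 * m + 1) choose m"
proof -
  have "fact m * fact (m + 1) * ((2 * m + 1) choose m) = (fact (2 * m + 1) :: nat)"
    using binomial_fact_lemma[of m "2 * m + 1"] by (simp add: mult_2 algebra_simps)
  moreover have "p dvd fact (2 * m + 1)"
    using assms by (simp only: prime_dvd_fact_iff) auto
  moreover have "\<not> p dvd fact m" "\<not> p dvd fact (m + 1)" 
    using assms by (simp_all only: prime_dvd_fact_iff) auto
  ultimately show ?thesis using assms by (metis prime_dvd_mult_iff)
qed

text \<open>The two equal middle entries of row \<open>2 * m + 1\<close> sum to at most the whole
  row.\<close>

lemma choose_odd_le: "(2 * m + 1) choose m \<le> 4 ^ m"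
proof -
  have "2 * ((2 * m + 1) choose m) = (\<Sum>k\<in>{m, m + 1}. (2 * m + 1) choose k)"
    using binomial_symmetric[of m "2 * m + 1"] by simp
  also have "\<dots> \<le> (\<Sum>k\<le>2 * m + 1. (2 * m + 1) choose k)"
    by (rule sum_mono2) auto
  also have "\<dots> = 2 * 4 ^ m" unfolding choose_row_sum by (simp add: power_mult)
  finally show ?thesis by simp
qed

lemma prod_prime_powers_dvd:
  assumes "finite A" "\<And>p. p \<in> A \<Longrightarrow> prime (p::nat)" "\<And>p. p \<in> A \<Longrightarrow> p ^ e p dvd c"
  shows "(\<Prod>p\<in>A. p ^ e p) dvd c"
  using assms
proof (induction A rule: finite_induct)
  case (insert p A)
  have "coprime (p ^ e p) (\<Prod>q\<in>A. q ^ e q)"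
    using insert by (intro prod_coprime_right coprime_power_left_iff[THEN iffD2] disjI1
        coprime_power_right_iff[THEN iffD2]) (metis insertCI primes_coprime)
  then show ?case using insert by (simp add: divides_mult)
qed auto

text \<open>Erdos's induction: an even \<open>n > 2\<close> adds no prime, and for
  \<open>n = 2 * m + 1\<close> the primes above \<open>m + 1\<close> all divide
  \<open>(2 * m + 1) choose m\<close>, which is at most \<open>4 ^ m\<close>.\<close>

lemma primorial_le: "\<Prod>{p. prime p \<and> p \<le> (n::nat)} \<le> 4 ^ n"
proof (induction n rule: less_induct)
  case (less n)
  consider "n \<le> 2" | "n > 2" "even n" | m where "n = 2 * m + 1" "m > 0"
  proof (cases "even n")
    case False
    then obtain m where "n = 2 * m + 1" by (elim oddE)
    then show ?thesis using that by (cases "m = 0") auto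
  qed (use that in linarith)
  then show ?case
  proof cases
    case 1
    then have "{p. prime p \<and> p \<le> n} \<subseteq> {2}" using prime_ge_2_nat by (auto intro: le_antisym)
    then have "{p. prime p \<and> p \<le> n} = {} \<or> n = 2 \<and> {p. prime p \<and> p \<le> n} = {2}"
      using 1 by auto
    then show ?thesis
    proof
      assume n: "n = 2 \<and> {p. prime p \<and> p \<le> n} = {2}"
      show ?thesis unfolding conjunct2[OF n] using n by simp
    next
      assume n: "{p. prime p \<and> p \<le> n} = {}"
      show ?thesis unfolding n by simp
    qed
  next
    case 2
    have "{p. prime p \<and> p \<le> n} = {p. prime p \<and> p \<le> n - 1}"
    proof -
      have "\<not> prime n" using 2 prime_odd_nat by blast
      then have "p \<le> n - 1" if "prime p" "p \<le> n" for p
        using that by (cases "p = n") auto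
      then show ?thesis by fastforce
    qed
    moreover have "4 ^ (n - 1) \<le> (4 ^ n :: nat)" by (intro power_increasing) auto
    ultimately show ?thesis using less[of "n - 1"] 2 by (metis diff_less le_trans less_trans pos2 zero_less_one)
  next
    case (3 m)
    let ?P = "\<lambda>A. {p. prime p \<and> p \<in> A}"
    have fin: "finite (?P A)" if "finite A" for A :: "nat set" using that by auto
    have "{p. prime p \<and> p \<le> n} = {p. prime p \<and> p \<le> m + 1} \<union> ?P {m + 1<..2 * m + 1}"
      using 3 by auto
    then have "\<Prod>{p. prime p \<and> p \<le> n} = \<Prod>{p. prime p \<and> p \<le> m + 1} * \<Prod>(?P {m + 1<..2 * m + 1})"
      by (simp only:) (subst prod.union_disjoint, auto)
    also have "\<dots> \<le> 4 ^ (m + 1) * 4 ^ m"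
    proof (intro mult_mono)
      show "\<Prod>{p. prime p \<and> p \<le> m + 1} \<le> 4 ^ (m + 1)" using 3 by (intro less) auto
      have "(\<Prod>p\<in>?P {m + 1<..2 * m + 1}. p ^ 1) dvd (2 * m + 1) choose m"
      proof (rule prod_prime_powers_dvd)
        show "p ^ 1 dvd (2 * m + 1) choose m" if "p \<in> ?P {m + 1<..2 * m + 1}" for p
          using that prime_dvd_choose_odd[of p m] by (simp only: power_one_right mem_Collect_eq)
      qed (use fin in simp_all)
      then have "\<Prod>(?P {m + 1<..2 * m + 1}) dvd (2 * m + 1) choose m"
        by (simp only: power_one_right)
      then have "\<Prod>(?P {m + 1<..2 * m + 1}) \<le> (2 * m + 1) choose m"
        by (rule dvd_imp_le) (simp del: binomial_Suc_Suc add: zero_less_binomial)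
      then show "\<Prod>(?P {m + 1<..2 * m + 1}) \<le> 4 ^ m" using choose_odd_le le_trans by blast
    qed auto
    also have "\<dots> = 4 ^ n" using 3 by (simp add: power_add mult_2)
    finally show ?thesis .
  qed
qed

text \<open>Primes other than 2 and 3 are 1 or 5 modulo 6, so division by 3 is injective on them.
  Density 1/3 is good enough: \<open>card_large_prime_multiples_ge_linear\<close> needs a density
  below 2/5.\<close>

lemma card_primes_le: "3 * card {p. prime p \<and> p \<le> (n::nat)} \<le> n + 6"
proof -
  let ?A = "{p::nat. prime p \<and> p \<le> n} - {2, 3}"
  define f where "f p = p div 3" for p :: nat
  have mod6: "\<exists>k. p = 6 * k + 1 \<or> p = 6 * k + 5" if "p \<in> ?A" for p
  proof -
    have "prime p" "p \<noteq> 2" "p \<noteq> 3" "prime (3::nat)" using that by simp_all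
    then have "\<not> 2 dvd p" "\<not> 3 dvd p"
      using primes_dvd_imp_eq two_is_prime_nat by blast+
    then have "\<not> 2 dvd p mod 6" "\<not> 3 dvd p mod 6" by (simp_all add: dvd_mod_iff)
    moreover have "p mod 6 < 6" by simp
    then have "p mod 6 = 0 \<or> p mod 6 = 1 \<or> p mod 6 = 2 \<or> p mod 6 = 3 \<or> p mod 6 = 4 \<or> p mod 6 = 5"
      by linarith
    ultimately have "p mod 6 = 1 \<or> p mod 6 = 5" by (elim disjE) simp_all
    moreover have "p = 6 * (p div 6) + p mod 6" by simp
    ultimately show ?thesis by metis
  qed
  have div3: "(6 * k + 1) div 3 = 2 * k" "(6 * k + 5) div 3 = 2 * k + 1" for k :: nat
    by (simp_all add: div_nat_eqI)
  have "inj_on f ?A"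
  proof (rule inj_onI)
    fix p q assume "p \<in> ?A" and "q \<in> ?A" and f: "f p = f q"
    obtain k where k: "p = 6 * k + 1 \<and> f p = 2 * k \<or> p = 6 * k + 5 \<and> f p = 2 * k + 1"
      using mod6[OF \<open>p \<in> ?A\<close>] div3 unfolding f_def by metis
    obtain l where l: "q = 6 * l + 1 \<and> f q = 2 * l \<or> q = 6 * l + 5 \<and> f q = 2 * l + 1"
      using mod6[OF \<open>q \<in> ?A\<close>] div3 unfolding f_def by metis
    show "p = q" using k l f by (elim disjE conjE; (linarith | (simp, presburger)))
  qed
  moreover have "f ` ?A \<subseteq> {1..n div 3}"
  proof (rule image_subsetI)
    fix p assume p: "p \<in> ?A"
    then have "2 \<le> p" "p \<noteq> 2" "p \<le> n" by (auto simp: prime_ge_2_nat)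
    then have "3 div 3 \<le> p div 3" "p div 3 \<le> n div 3" by (intro div_le_mono; simp)+
    then show "f p \<in> {1..n div 3}" by (simp add: f_def)
  qed
  ultimately have "card ?A \<le> n div 3"
    using card_inj_on_le[of f ?A "{1..n div 3}"] by simp
  moreover have "card {p::nat. prime p \<and> p \<le> n} \<le> card (?A \<union> {2, 3})"
    by (rule card_mono) auto
  moreover have "card (?A \<union> {2, 3}) \<le> card ?A + card {2, 3::nat}" by (rule card_Un_le)
  ultimately have "card {p::nat. prime p \<and> p \<le> n} \<le> n div 3 + 2" by simp
  then show ?thesis by simp
qed

section \<open>Comparing a binomial coefficient with the contribution of its small primes\<close>

definition large_prime_multiples :: "nat \<Rightarrow> nat \<Rightarrow> nat set" where
  "large_prime_multiples a b = {m \<in> {b<..b + a}. \<exists>p. prime p \<and> p > a \<and> p dvd m}"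

lemma prod_interval_eq: "\<Prod>{b<..b + a} = ((a + b) choose a) * fact a"
proof -
  have "\<Prod>{b<..b + a} * fact b = fact (b + a)"
  proof (induction a)
    case (Suc a)
    have "{b<..b + Suc a} = insert (b + Suc a) {b<..b + a}" by auto
    then show ?case using Suc by (simp add: algebra_simps)
  qed simp
  moreover have "fact a * fact b * ((a + b) choose a) = (fact (a + b) :: nat)"
    using binomial_fact_lemma[of a "a + b"] by simp
  ultimately have "\<Prod>{b<..b + a} * fact b = ((a + b) choose a) * fact a * fact b"
    by (simp add: algebra_simps)
  then show ?thesis by simp
qed

text \<open>Primes above \<open>a\<close> divide only those factors of \<open>{b<..b + a}\<close>
  that lie in \<open>large_prime_multiples a b\<close>. Their part of the coefficient therefore
  divides the product of these factors, each at most \<open>a + b\<close>.\<close>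

lemma choose_le_small_primes_part:
  "(a + b) choose a \<le> (\<Prod>p | prime p \<and> p \<le> a. p ^ multiplicity p ((a + b) choose a))
     * (a + b) ^ card (large_prime_multiples a b)"
proof -
  let ?C = "(a + b) choose a" and ?G = "large_prime_multiples a b"
  let ?f = "\<lambda>p. p ^ multiplicity p ?C"
  define P where "P = {p \<in> prime_factors ?C. p \<le> a}"
  define Q where "Q = {p \<in> prime_factors ?C. p > a}"
  have fin: "finite ?G" by (simp add: large_prime_multiples_def)
  have "?C = prod ?f (prime_factors ?C)"
    by (rule prime_factorization_nat) (simp add: zero_less_binomial)
  also have "prime_factors ?C = P \<union> Q" by (auto simp: P_def Q_def)
  also have "prod ?f (P \<union> Q) = prod ?f P * prod ?f Q"
    by (rule prod.union_disjoint) (auto simp: P_def Q_def)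
  also have "prod ?f P = (\<Prod>p | prime p \<and> p \<le> a. ?f p)"
    by (rule prod.mono_neutral_left)
      (auto simp: P_def in_prime_factors_iff, metis less_irrefl not_dvd_imp_multiplicity_0)
  also have "prod ?f Q \<le> (a + b) ^ card ?G"
  proof -
    have "?f p dvd \<Prod>?G" if p: "p \<in> Q" for p
    proof -
      have pp: "prime p" "p > a" using p by (auto simp: Q_def)
      have "?f p dvd \<Prod>{b<..b + a}"
        unfolding prod_interval_eq by (simp add: multiplicity_dvd)
      also have "{b<..b + a} = ?G \<union> ({b<..b + a} - ?G)" by (auto simp: large_prime_multiples_def)
      also have "\<Prod>\<dots> = \<Prod>?G * \<Prod>({b<..b + a} - ?G)"
        by (rule prod.union_disjoint) (auto simp: fin)
      finally have "?f p dvd \<Prod>?G * \<Prod>({b<..b + a} - ?G)" .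
      moreover have "coprime (?f p) (\<Prod>({b<..b + a} - ?G))"
        using pp by (intro prod_coprime_right coprime_power_left_iff[THEN iffD2] disjI1 prime_imp_coprime)
          (auto simp: large_prime_multiples_def)
      ultimately show ?thesis by (simp add: coprime_dvd_mult_left_iff)
    qed
    then have "prod ?f Q dvd \<Prod>?G"
      by (intro prod_prime_powers_dvd) (auto simp: Q_def)
    then have "prod ?f Q \<le> \<Prod>?G"
      by (rule dvd_imp_le) (auto simp: large_prime_multiples_def intro!: prod_pos)
    also have "\<dots> \<le> (a + b) ^ card ?G"
      by (rule order.trans[OF prod_mono[of _ _ "\<lambda>_. a + b"]])
        (auto simp: large_prime_multiples_def)
    finally show ?thesis .
  qed
  finally show ?thesis by simp
qed

lemma choose_le_power:
  assumes "a + b > 0"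
  shows "(a + b) choose a \<le>
    (a + b) ^ (card {p. prime p \<and> p \<le> a} + card (large_prime_multiples a b))"
proof -
  have "(\<Prod>p | prime p \<and> p \<le> a. p ^ multiplicity p ((a + b) choose a))
      \<le> (\<Prod>p | prime p \<and> p \<le> a. a + b)"
    using assms by (intro prod_mono) (auto intro: prime_power_multiplicity_choose_le)
  then show ?thesis
    using choose_le_small_primes_part[of a b] unfolding power_add prod_constant
    by (meson le_trans mult_le_mono1)
qed

text \<open>Sharper than \<open>choose_le_power\<close> when \<open>b\<close> is not much larger
  than \<open>a\<close>: only primes up to \<open>s\<close>, about the square root of
  \<open>a + b\<close>, may occur to higher powers. The rest up to \<open>c\<close> occur at most
  once and are covered by the primorial bound.\<close>

lemma choose_le_four_power:
  assumes pos: "a + b > 0" and s: "a + b < (s + 1) ^ 2" and c: "c \<le> a"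
    and zero: "\<And>p. prime p \<Longrightarrow> c < p \<Longrightarrow> p \<le> a \<Longrightarrow> multiplicity p ((a + b) choose a) = 0"
  shows "(a + b) choose a \<le> (a + b) ^ (s + card (large_prime_multiples a b)) * 4 ^ c"
proof -
  let ?C = "(a + b) choose a" and ?P = "{p. prime p \<and> p \<le> a}"
  \<comment> \<open>The two factors are switched on independently, so the product splits; for
    \<open>p\<close> below both \<open>s\<close> and \<open>c\<close> the extra factor
    \<open>p\<close> only weakens the bound.\<close>
  have "(\<Prod>p\<in>?P. p ^ multiplicity p ?C)
      \<le> (\<Prod>p\<in>?P. (if p \<le> s then a + b else 1) * (if p \<le> c then p else 1))"
  proof (intro prod_mono conjI)
    fix p assume p: "p \<in> ?P"
    then have p1: "p \<ge> 1" by (simp add: prime_ge_Suc_0_nat)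
    consider "p \<le> s" | "s < p" "p \<le> c" | "c < p" by linarith
    then show "p ^ multiplicity p ?C \<le> (if p \<le> s then a + b else 1) * (if p \<le> c then p else 1)"
    proof cases
      case 1
      have "p ^ multiplicity p ?C \<le> a + b"
        using p pos by (auto intro: prime_power_multiplicity_choose_le)
      also have "a + b \<le> (a + b) * (if p \<le> c then p else 1)" using p1 by simp
      finally show ?thesis using 1 by simp
    next
      case 2
      have "(s + 1) ^ 2 \<le> p ^ 2" using 2 by (intro power_mono) auto
      then have "a + b < p ^ 2" using s by linarith
      then have "multiplicity p ?C \<le> 1"
        using p pos by (intro multiplicity_choose_le_1) auto
      then have "p ^ multiplicity p ?C \<le> p ^ 1" using p1 by (intro power_increasing) auto
      then show ?thesis using 2 by simp
    next
      case 3
      then have "multiplicity p ?C = 0" using p zero by auto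
      then show ?thesis using pos p1 by (simp add: Suc_le_eq)
    qed
  qed auto
  also have "\<dots> = (a + b) ^ card {p \<in> ?P. p \<le> s} * \<Prod>{p \<in> ?P. p \<le> c}"
    by (simp add: prod.distrib prod.If_cases Int_def)
  also have "{p \<in> ?P. p \<le> c} = {p. prime p \<and> p \<le> c}" using c by auto
  also have "(a + b) ^ card {p \<in> ?P. p \<le> s} * \<Prod>{p. prime p \<and> p \<le> c} \<le> (a + b) ^ s * 4 ^ c"
  proof (intro mult_mono primorial_le power_increasing)
    have "{p \<in> ?P. p \<le> s} \<subseteq> {1..s}" by (auto simp: prime_ge_Suc_0_nat)
    then have "card {p \<in> ?P. p \<le> s} \<le> card {1..s}" by (intro card_mono) auto
    then show "card {p \<in> ?P. p \<le> s} \<le> s" by simp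
  qed (use pos in auto)
  finally have "(\<Prod>p\<in>?P. p ^ multiplicity p ?C) \<le> (a + b) ^ s * 4 ^ c" .
  from mult_le_mono1[OF this, of "(a + b) ^ card (large_prime_multiples a b)"]
  have "?C \<le> (a + b) ^ s * 4 ^ c * (a + b) ^ card (large_prime_multiples a b)"
    using choose_le_small_primes_part[of a b] by (rule le_trans[rotated])
  also have "\<dots> = (a + b) ^ (s + card (large_prime_multiples a b)) * 4 ^ c"
    by (simp only: power_add mult_ac)
  finally show ?thesis .
qed

text \<open>Put N = a + b. The hypothesis says N/a >= N^(2/5), so (N/a)^a, a lower bound for the
  binomial coefficient, is at least N^(2a/5). Comparing exponents with
  \<open>choose_le_power\<close> leaves a positive proportion of \<open>a\<close>, since 2/5 >
  1/3.\<close>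

lemma card_large_prime_multiples_ge_linear:
  assumes "a \<ge> 2" "a ^ 5 \<le> (a + b) ^ 3"
  shows "a \<le> 15 * card (large_prime_multiples a b) + 30"
proof -
  let ?N = "real (a + b)" and ?e = "card {p. prime p \<and> p \<le> a} + card (large_prime_multiples a b)"
  have N: "?N > 1" "real a > 0" using assms by auto
  have "real (a ^ 5) \<le> real ((a + b) ^ 3)" using assms(2) by (simp only: of_nat_le_iff)
  then have "?N ^ 2 * real a ^ 5 \<le> ?N ^ 2 * ?N ^ 3"
    by (intro mult_left_mono) auto
  then have "?N ^ 2 \<le> (?N / real a) ^ 5"
    using N by (simp add: power_divide field_simps flip: power_add)
  then have "(?N ^ 2) ^ a \<le> ((?N / real a) ^ 5) ^ a" by (intro power_mono) auto
  also have "\<dots> = ((?N / real a) ^ a) ^ 5" by (simp add: mult.commute flip: power_mult)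
  also have "\<dots> \<le> real ((a + b) choose a) ^ 5"
    by (intro power_mono binomial_ge_n_over_k_pow_k) auto
  also have "\<dots> \<le> (?N ^ ?e) ^ 5"
  proof (intro power_mono)
    have "real ((a + b) choose a) \<le> real ((a + b) ^ ?e)"
      using choose_le_power[of a b] assms by (simp only: of_nat_le_iff)
    then show "real ((a + b) choose a) \<le> ?N ^ ?e" by simp
  qed simp
  finally have "?N ^ (2 * a) \<le> ?N ^ (?e * 5)" by (simp flip: power_mult)
  then have "2 * a \<le> ?e * 5" using N(1) power_le_imp_le_exp by blast
  then have "6 * a \<le> 5 * (3 * card {p. prime p \<and> p \<le> a}) + 15 * card (large_prime_multiples a b)"
    by (simp add: algebra_simps)
  also have "\<dots> \<le> 5 * (a + 6) + 15 * card (large_prime_multiples a b)"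
    using card_primes_le[of a] by (intro add_right_mono mult_left_mono) auto
  finally show ?thesis by simp
qed

text \<open>The ratio of consecutive values of \<open>(3 * a) choose a\<close>, which tends to 27/4,
  written without division.\<close>

lemma choose_3_Suc:
  "((3 * a + 3) choose (a + 1)) * ((2 * a + 1) * (2 * a + 2)) = ((3 * a) choose a) * (3 * (3 * a + 1) * (3 * a + 2))"
proof -
  have 1: "fact a * fact (2 * a) * ((3 * a) choose a) = (fact (3 * a) :: nat)"
    using binomial_fact_lemma[of a "3 * a"] by simp
  have 2: "fact (a + 1) * fact (2 * a + 2) * ((3 * a + 3) choose (a + 1)) = (fact (3 * a + 3) :: nat)"
    using binomial_fact_lemma[of "a + 1" "3 * a + 3"] by simp
  have f3: "fact (3 * a + 3) = 3 * (a + 1) * (3 * a + 2) * (3 * a + 1) * (fact (3 * a) :: nat)"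
    by (simp add: numeral_3_eq_3 algebra_simps)
  have f2: "fact (2 * a + 2) = (2 * a + 2) * (2 * a + 1) * (fact (2 * a) :: nat)"
    by (simp add: algebra_simps)
  have f1: "fact (a + 1) = (a + 1) * (fact a :: nat)" by simp
  have "(fact a * fact (2 * a) * (a + 1)) * (((3 * a + 3) choose (a + 1)) * ((2 * a + 1) * (2 * a + 2)))
     = (fact a * fact (2 * a) * (a + 1)) * (((3 * a) choose a) * (3 * (3 * a + 1) * (3 * a + 2)))"
  proof -
    have "(fact a * fact (2 * a) * (a + 1)) * (((3 * a + 3) choose (a + 1)) * ((2 * a + 1) * (2 * a + 2)))
      = fact (a + 1) * fact (2 * a + 2) * ((3 * a + 3) choose (a + 1))"
      unfolding f1 f2 by (simp only: mult_ac)
    also have "\<dots> = 3 * (a + 1) * (3 * a + 2) * (3 * a + 1) * (fact a * fact (2 * a) * ((3 * a) choose a))"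
      unfolding 2 f3 1 ..
    finally show ?thesis by (simp only: mult_ac)
  qed
  then show ?thesis by (subst (asm) mult_cancel1) simp
qed

text \<open>The growth rate \<open>27/4\<close> of \<open>(3a choose a)\<close> exceeds \<open>4\<^sup>4\<^sup>/\<^sup>3\<close>, and so does \<open>13/2\<close>.\<close>
lemma choose_3_ge: "(13 / 2) ^ a \<le> (13 / 2) ^ 13 * real ((3 * a) choose a)"
proof (induction a)
  case (Suc a)
  have pos: "(3 * m) choose m \<ge> 1" for m by (simp add: Suc_le_eq zero_less_binomial)
  show ?case
  \<comment> \<open>The ratio reaches 13/2 once a^2 >= 12 a + 7, that is from a = 13 on; the factor
    \<open>(13 / 2) ^ 13\<close> absorbs the smaller values.\<close>
  proof (cases "a < 13")
    case True
    have "(13 / 2) ^ Suc a \<le> ((13 / 2) ^ 13 :: real)"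
      using True by (intro power_increasing) auto
    also have "\<dots> \<le> (13 / 2) ^ 13 * real ((3 * Suc a) choose Suc a)"
      using pos[of "Suc a"] by (simp only: mult_le_cancel_left1) auto
    finally show ?thesis .
  next
    case False
    let ?x = "real ((3 * a) choose a)" and ?y = "real ((3 * a + 3) choose (a + 1))"
    define D where "D = real ((2 * a + 1) * (2 * a + 2))"
    have a: "13 * real a \<le> real a * real a" using False by (intro mult_right_mono) auto
    have "D = 4 * (real a * real a) + 6 * real a + 2" by (simp add: D_def algebra_simps)
    moreover have "real (3 * (3 * a + 1) * (3 * a + 2)) = 27 * (real a * real a) + 27 * real a + 6"
      by (simp add: algebra_simps)
    ultimately have "13 / 2 * D \<le> real (3 * (3 * a + 1) * (3 * a + 2))"
      using a False by linarith
    then have "?x * (13 / 2 * D) \<le> ?x * real (3 * (3 * a + 1) * (3 * a + 2))"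
      by (rule mult_left_mono) simp
    also have "\<dots> = ?y * D"
      using arg_cong[OF choose_3_Suc[of a], of real] unfolding D_def of_nat_mult[symmetric]
      by (simp only:)
    finally have "(13 / 2 * ?x) * D \<le> ?y * D" by simp
    moreover have "D > 0" unfolding D_def of_nat_0_less_iff by simp
    ultimately have "13 / 2 * ?x \<le> ?y" by (rule mult_right_le_imp_le)
    then have le: "(13 / 2) ^ 13 * (13 / 2 * ?x) \<le> (13 / 2) ^ 13 * ?y"
      by (rule mult_left_mono) simp
    have "(13 / 2) ^ Suc a \<le> 13 / 2 * ((13 / 2) ^ 13 * ?x)"
      using Suc unfolding power_Suc by (rule mult_left_mono) simp
    also have "\<dots> = (13 / 2) ^ 13 * (13 / 2 * ?x)" by (simp only: mult_ac)
    also note le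
    finally have "(13 / 2) ^ Suc a \<le> (13 / 2) ^ 13 * ?y" .
    moreover have "3 * Suc a = 3 * a + 3" "Suc a = a + 1" by simp_all
    ultimately show ?thesis by (simp only:)
  qed
qed simp

section \<open>Integers with a large prime factor in short intervals\<close>

lemma choose_le_choose:
  assumes "a \<le> c" "b \<le> d"
  shows "(a + b) choose a \<le> (c + d) choose c"
proof -
  have "(a + b) choose a \<le> (a + d) choose a"
    using assms by (intro binomial_right_mono) simp
  also have "\<dots> = (a + d) choose d" by (subst binomial_symmetric) auto
  also have "\<dots> \<le> (c + d) choose d"
    using assms by (intro binomial_right_mono) simp
  also have "\<dots> = (c + d) choose c" by (subst binomial_symmetric) auto
  finally show ?thesis .
qed

lemma nat_sqrt_bounds:
  obtains s where "real s \<le> sqrt (real N)" "N < (s + 1) ^ 2"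
proof
  let ?s = "nat \<lfloor>sqrt (real N)\<rfloor>"
  show "real ?s \<le> sqrt (real N)" by simp
  have "sqrt (real N) < real (?s + 1)" by linarith
  then have "sqrt (real N) ^ 2 < real (?s + 1) ^ 2" by (intro power_strict_mono) auto
  then have "real N < real ((?s + 1) ^ 2)" by simp
  then show "N < (?s + 1) ^ 2" by (simp only: of_nat_less_iff)
qed

text \<open>The common core of two ranges: \<open>d = a\<close>, \<open>c = a\<close> (making
  \<open>zero\<close> vacuous) when \<open>2 * a \<le> b\<close>, and \<open>d = b div 2\<close>,
  \<open>c = (a + b) div 3\<close> when \<open>a \<le> b < 2 * a\<close>.\<close>

lemma choose_3_ln_le:
  assumes s: "real s \<le> sqrt (real (a + b))" "a + b < (s + 1) ^ 2" and pos: "a + b > 0"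
    and c: "c \<le> a" and d: "d \<le> a" "2 * d \<le> b"
    and zero: "\<And>p. prime p \<Longrightarrow> c < p \<Longrightarrow> p \<le> a \<Longrightarrow> multiplicity p ((a + b) choose a) = 0"
  shows "real d * ln (13 / 2) \<le> 13 * ln (13 / 2)
    + (real s + real (card (large_prime_multiples a b))) * ln (real (a + b)) + real c * ln 4"
proof -
  let ?g = "card (large_prime_multiples a b)"
  have "(3 * d) choose d \<le> (a + b) choose a"
    using choose_le_choose[OF d] by simp
  also have "\<dots> \<le> (a + b) ^ (s + ?g) * 4 ^ c"
    using assms by (intro choose_le_four_power) auto
  finally have "real ((3 * d) choose d) \<le> real ((a + b) ^ (s + ?g) * 4 ^ c)"
    by (simp only: of_nat_le_iff)
  then have "(13 / 2) ^ 13 * real ((3 * d) choose d) \<le> (13 / 2) ^ 13 * real ((a + b) ^ (s + ?g) * 4 ^ c)"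
    by (rule mult_left_mono) simp
  with choose_3_ge have "(13 / 2) ^ d \<le> (13 / 2) ^ 13 * real ((a + b) ^ (s + ?g) * 4 ^ c)"
    by (rule order.trans)
  then have "ln ((13 / 2) ^ d) \<le> ln ((13 / 2) ^ 13 * (real (a + b) ^ (s + ?g) * 4 ^ c))"
    using pos by (subst ln_le_cancel_iff) (auto simp del: of_nat_add)
  also have "\<dots> = ln ((13 / 2) ^ 13) + (ln (real (a + b) ^ (s + ?g)) + ln (4 ^ c))"
  proof -
    have ln3: "ln (x * (y * z)) = ln x + (ln y + ln z)" if "x > 0" "y > 0" "z > 0" for x y z :: real
      using that by (simp add: ln_mult)
    then show ?thesis using pos by (intro ln3) (simp_all del: of_nat_add)
  qed
  also have "\<dots> = 13 * ln (13 / 2) + (real (s + ?g) * ln (real (a + b)) + real c * ln 4)"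
    using pos by (subst (1 2 3) ln_realpow) (auto simp del: of_nat_add)
  finally show ?thesis by (simp add: ln_realpow)
qed

text \<open>Here a + b < a^(5/3), so the primes up to the square root of a + b supply at most
  a^(5/6) factors \<open>a + b\<close>. The gain of (13/2)^a over 4^a then forces a count of order a
  / ln a, which beats any power with exponent below 1.\<close>

lemma card_large_prime_multiples_ge_powr:
  "\<exists>a0. \<forall>a\<ge>a0. \<forall>b. 2 * a \<le> b \<longrightarrow> (a + b) ^ 3 < a ^ 5 \<longrightarrow>
     real a powr (87 / 100) \<le> real (card (large_prime_multiples a b))"
proof -
  define \<delta> where "\<delta> = ln (13 / 2) - ln (4 :: real)"
  define K where "K = 13 * ln (13 / 2 :: real)"
  have \<delta>: "\<delta> > 0" by (simp add: \<delta>_def)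
  then have "eventually (\<lambda>x::real. x powr (87 / 100) \<le> (\<delta> * x - K) / (5 / 3 * ln x) - x powr (5 / 6)) at_top"
    by real_asymp
  then obtain x0 where x0: "\<And>x. x \<ge> x0 \<Longrightarrow>
      x powr (87 / 100) \<le> (\<delta> * x - K) / (5 / 3 * ln x) - x powr (5 / 6)"
    by (auto simp: eventually_at_top_linorder)
  show ?thesis
  proof (intro exI allI impI)
    fix a b assume a: "a \<ge> max 2 (nat \<lceil>x0\<rceil>)" and b: "2 * a \<le> b" and ab: "(a + b) ^ 3 < a ^ 5"
    let ?g = "card (large_prime_multiples a b)" and ?N = "real (a + b)"
    have a1: "a > 1" "real a \<ge> x0" using a by linarith+
    have pos: "a + b > 0" using a1 by simp
    obtain s where s: "real s \<le> sqrt ?N" "a + b < (s + 1) ^ 2" using nat_sqrt_bounds by blast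
    have "real a * ln (13 / 2) \<le> K + (real s + real ?g) * ln ?N + real a * ln 4"
      unfolding K_def using s pos b by (intro choose_3_ln_le) auto
    then have 1: "\<delta> * real a - K \<le> (real s + real ?g) * ln ?N"
      unfolding \<delta>_def by (simp add: algebra_simps)
    have "real ((a + b) ^ 3) \<le> real (a ^ 5)" using ab by (simp only: of_nat_le_iff less_imp_le)
    then have "?N ^ 3 \<le> real a ^ 5" by simp
    then have "ln (?N ^ 3) \<le> ln (real a ^ 5)" using a1 pos by (subst ln_le_cancel_iff) auto
    then have lnN: "ln ?N \<le> 5 / 3 * ln (real a)" using a1 pos by (simp add: ln_realpow del: of_nat_add)
    have "\<delta> * real a - K \<le> (real s + real ?g) * (5 / 3 * ln (real a))"
      using 1 lnN by (rule order.trans[OF _ mult_left_mono]) auto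
    then have 2: "(\<delta> * real a - K) / (5 / 3 * ln (real a)) \<le> real s + real ?g"
      using a1 by (subst pos_divide_le_eq) auto
    have "real s \<le> ?N powr (1 / 2)" using s by (simp add: powr_half_sqrt)
    also have "\<dots> = exp (1 / 2 * ln ?N)" using pos by (simp add: powr_def del: of_nat_add)
    also have "\<dots> \<le> exp (5 / 6 * ln (real a))" using lnN by simp
    also have "\<dots> = real a powr (5 / 6)" using a1 by (simp add: powr_def)
    finally show "real a powr (87 / 100) \<le> real ?g" using x0[OF a1(2)] 2 by linarith
  qed
qed

lemma card_large_prime_multiples_ge:
  "\<exists>i0. \<forall>i\<ge>i0. \<forall>a b. 8 ^ i \<le> a \<longrightarrow> 2 * a \<le> b \<longrightarrow> 6 ^ i \<le> card (large_prime_multiples a b)"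
proof -
  obtain a0 where a0: "\<And>a b. a0 \<le> a \<Longrightarrow> 2 * a \<le> b \<Longrightarrow> (a + b) ^ 3 < a ^ 5 \<Longrightarrow>
     real a powr (87 / 100) \<le> real (card (large_prime_multiples a b))"
    using card_large_prime_multiples_ge_powr by blast
  have "eventually (\<lambda>i. 15 * 6 ^ i + 30 \<le> (8 ^ i :: real)) sequentially" by real_asymp
  then obtain i1 where i1: "\<And>i. i \<ge> i1 \<Longrightarrow> 15 * 6 ^ i + 30 \<le> (8 ^ i :: real)"
    by (auto simp: eventually_at_top_linorder)
  show ?thesis
  proof (intro exI allI impI)
    fix i a b assume i: "i \<ge> max 1 (max i1 a0)" and a: "8 ^ i \<le> a" and b: "2 * a \<le> (b::nat)"
    have "i < 8 ^ i" by (rule less_le_trans[OF less_exp power_mono]) auto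
    then have a1: "a \<ge> 2" "a \<ge> a0" using i a by linarith+
    show "6 ^ i \<le> card (large_prime_multiples a b)"
    proof (cases "a ^ 5 \<le> (a + b) ^ 3")
      case True
      then have "a \<le> 15 * card (large_prime_multiples a b) + 30"
        using card_large_prime_multiples_ge_linear a1 by blast
      moreover have "real (15 * 6 ^ i + 30) \<le> real (8 ^ i)" using i1 i by simp
      then have "15 * 6 ^ i + 30 \<le> (8 ^ i :: nat)" by (simp only: of_nat_le_iff)
      ultimately show ?thesis using a by linarith
    next
      case False
      \<comment> \<open>The exponent 87/100 is a rational number just above log 6 / log 8, so the
        power bound at \<open>8 ^ i\<close> yields \<open>6 ^ i\<close>.\<close>
      have "ln (6 ^ 100 :: real) \<le> ln (8 ^ 87)" by (subst ln_le_cancel_iff) simp_all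
      then have "ln 6 \<le> 87 / 100 * ln (8 :: real)" unfolding ln_realpow by simp
      then have "exp (ln 6) \<le> exp (87 / 100 * ln (8 :: real))" by (simp only: exp_le_cancel_iff)
      then have "6 \<le> 8 powr (87 / 100 :: real)" by (simp add: powr_def)
      then have "6 ^ i \<le> (8 powr (87 / 100 :: real)) ^ i" by (intro power_mono) auto
      also have "\<dots> = (8 ^ i) powr (87 / 100)" by (induction i) (simp_all add: powr_mult)
      also have "\<dots> \<le> real a powr (87 / 100)"
      proof (intro powr_mono2)
        have "real (8 ^ i) \<le> real a" using a by (simp only: of_nat_le_iff)
        then show "8 ^ i \<le> real a" by simp
      qed auto
      also have "\<dots> \<le> real (card (large_prime_multiples a b))"
        using False by (intro a0[OF a1(2) b]) simp
      finally have "real (6 ^ i) \<le> real (card (large_prime_multiples a b))" by simp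
      then show ?thesis by (simp only: of_nat_le_iff)
    qed
  qed
qed

text \<open>If the set were empty, the coefficient would be at most about 4^((a + b)/3), since
  primes in ((a + b)/3, a] do not divide it. With \<open>d = b div 2\<close> this exponent is about
  4d/3 at most, against the lower bound of order (13/2)^d.\<close>

lemma large_prime_multiples_nonempty:
  "\<exists>a0. \<forall>a\<ge>a0. \<forall>b. a \<le> b \<longrightarrow> b < 2 * a \<longrightarrow> large_prime_multiples a b \<noteq> {}"
proof -
  define \<delta> where "\<delta> = ln (13 / 2) - 4 / 3 * ln (4 :: real)"
  define K where "K = 13 * ln (13 / 2 :: real) + 2 / 3 * ln 4"
  \<comment> \<open>The decisive numerical fact: (13/2)^3 = 274.625 exceeds 4^4 = 256.\<close>
  have "ln (4 ^ 4) < ln ((13 / 2) ^ 3 :: real)" by (subst ln_less_cancel_iff) (auto simp: power_divide)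
  then have "\<delta> > 0" using ln_realpow[of 4 4] by (simp add: \<delta>_def ln_realpow)
  then have "eventually (\<lambda>x::real. K + sqrt (4 * x + 2) * ln (4 * x + 2) < \<delta> * x) at_top"
    by real_asymp
  then obtain x0 where x0: "\<And>x. x \<ge> x0 \<Longrightarrow> K + sqrt (4 * x + 2) * ln (4 * x + 2) < \<delta> * x"
    by (auto simp: eventually_at_top_linorder)
  show ?thesis
  proof (intro exI allI impI notI)
    fix a b assume a: "a \<ge> 2 * nat \<lceil>x0\<rceil> + 10" and b: "a \<le> b" "b < 2 * a"
      and empty: "large_prime_multiples a b = {}"
    define d where "d = b div 2"
    have d: "d \<ge> nat \<lceil>x0\<rceil>" "d \<le> a" "2 * d \<le> b" "b \<le> 2 * d + 1"
      using a b unfolding d_def by linarith+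
    define c where "c = (a + b) div 3"
    have "c * 3 \<le> a + b" "a + b < 3 + c * 3"
      unfolding c_def by (rule div_times_less_eq_dividend, rule dividend_less_div_times) simp
    then have c: "3 * c \<le> a + b" "a + b < 3 * (c + 1)"
      by simp_all
    have pos: "a + b > 0" using a by simp
    obtain s where s: "real s \<le> sqrt (real (a + b))" "a + b < (s + 1) ^ 2" using nat_sqrt_bounds by blast
    have "real d * ln (13 / 2) \<le> 13 * ln (13 / 2)
      + (real s + real (card (large_prime_multiples a b))) * ln (real (a + b)) + real c * ln 4"
    proof (rule choose_3_ln_le[OF s pos _ d(2,3)])
      show "c \<le> a" using b c by linarith
      fix p assume p: "prime p" "c < p" "p \<le> a"
      then show "multiplicity p ((a + b) choose a) = 0"
        using a b c by (intro multiplicity_choose_eq_0) auto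
    qed
    then have "real d * ln (13 / 2) \<le> 13 * ln (13 / 2) + real s * ln (real (a + b)) + real c * ln 4"
      by (simp add: empty)
    also have "real s * ln (real (a + b)) \<le> sqrt (4 * real d + 2) * ln (4 * real d + 2)"
    proof (intro mult_mono)
      have N: "real (a + b) \<le> 4 * real d + 2" using b d by linarith
      then have "sqrt (real (a + b)) \<le> sqrt (4 * real d + 2)" by (rule real_sqrt_le_mono)
      then show "real s \<le> sqrt (4 * real d + 2)" using s by linarith
      show "ln (real (a + b)) \<le> ln (4 * real d + 2)"
        using N pos by (subst ln_le_cancel_iff) (auto simp del: of_nat_add)
      show "0 \<le> ln (real (a + b))" using pos by (intro ln_ge_zero) linarith
    qed auto
    also have "real c * ln 4 \<le> (4 * real d + 2) / 3 * ln 4"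
      using b c d by (intro mult_right_mono) auto
    finally have "\<delta> * real d \<le> K + sqrt (4 * real d + 2) * ln (4 * real d + 2)"
      by (simp add: \<delta>_def K_def add_divide_distrib algebra_simps)
    moreover have "real d \<ge> x0" using d by linarith
    ultimately show False using x0[of "real d"] by linarith
  qed
qed

section \<open>Multiples of a prime and its order\<close>

text \<open>The product of these primes divides \<open>2 ^ d - 1\<close>, and each is at least
  2.\<close>

lemma card_prime_divisors_less:
  assumes "d \<ge> 1"
  shows "card {p. prime p \<and> p dvd (2 ^ d - 1 :: nat)} < d" "finite {p. prime p \<and> p dvd (2 ^ d - 1 :: nat)}"
proof -
  let ?M = "2 ^ d - 1 :: nat" and ?A = "{p. prime p \<and> p dvd (2 ^ d - 1 :: nat)}"
  have M: "?M > 0" using assms one_less_power[of "2::nat" d] by simp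
  have sub: "?A \<subseteq> {..?M}" using M by (auto intro: dvd_imp_le)
  then show fin: "finite ?A" by (rule finite_subset) simp
  have "2 ^ card ?A = (\<Prod>p\<in>?A. 2 :: nat)" by simp
  also have "\<dots> \<le> (\<Prod>p\<in>?A. p ^ 1)" by (intro prod_mono) (auto simp: prime_ge_2_nat)
  also have "\<dots> \<le> ?M" using M by (intro dvd_imp_le prod_prime_powers_dvd fin) auto
  also have "\<dots> < 2 ^ d" by simp
  finally show "card ?A < d" by (rule power_less_imp_less_exp[rotated]) simp
qed

text \<open>A prime of order \<open>d\<close> divides \<open>2 ^ d - 1\<close>, which has fewer than
  \<open>d\<close> prime divisors. The lower end 1 excludes the default value
  \<open>ord 2 2 = 0\<close>.\<close>

lemma card_primes_ord_le:
  "finite {p. prime p \<and> ord p (2::nat) \<in> {1..D}}" "card {p. prime p \<and> ord p (2::nat) \<in> {1..D}} \<le> D * D"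
proof -
  let ?A = "\<lambda>d. {p. prime p \<and> p dvd (2 ^ d - 1 :: nat)}"
  have "p dvd 2 ^ ord p (2::nat) - 1" for p :: nat
    using ord[of 2 p] by (subst (asm) cong_altdef_nat) auto
  then have sub: "{p. prime p \<and> ord p (2::nat) \<in> {1..D}} \<subseteq> (\<Union>d\<in>{1..D}. ?A d)" by blast
  have fin: "finite (\<Union>d\<in>{1..D}. ?A d)" using card_prime_divisors_less(2) by (intro finite_UN_I) auto
  show "finite {p. prime p \<and> ord p (2::nat) \<in> {1..D}}" using sub fin by (rule finite_subset)
  have "card {p. prime p \<and> ord p (2::nat) \<in> {1..D}} \<le> card (\<Union>d\<in>{1..D}. ?A d)"
    using sub fin by (intro card_mono)
  also have "\<dots> \<le> (\<Sum>d\<in>{1..D}. card (?A d))" by (rule card_UN_le) simp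
  also have "\<dots> \<le> (\<Sum>d\<in>{1..D}. D)"
    using card_prime_divisors_less(1) by (intro sum_mono) (meson atLeastAtMost_iff le_trans less_imp_le)
  finally show "card {p. prime p \<and> ord p (2::nat) \<in> {1..D}} \<le> D * D" by simp
qed

text \<open>Powers of \<open>8\<close> are used as scales because the cut-off for small orders is the cube root \<open>2\<^sup>j\<close>.\<close>
definition prime_block :: "nat \<Rightarrow> nat set" where
  "prime_block j = {p. prime p \<and> p \<in> {8 ^ j<..8 ^ Suc j} \<and> ord p (2::nat) \<ge> 1}"

text \<open>Split at order \<open>2 ^ j\<close>. At most \<open>4 ^ j\<close> primes have smaller or
  equal order, each contributing at most 1 / 8^j; the others number at most \<open>7 * 8 ^ j\<close>
  and contribute at most 1 / 16^j each. The totals are 1 and 7 times 2^(-j).\<close>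

lemma sum_prime_block_le: "(\<Sum>p\<in>prime_block j. 1 / real (p * ord p (2::nat))) \<le> 8 * (1 / 2) ^ j"
proof -
  define A where "A = {p \<in> prime_block j. ord p (2::nat) \<le> 2 ^ j}"
  define B where "B = {p \<in> prime_block j. \<not> ord p (2::nat) \<le> 2 ^ j}"
  have fin: "finite A" "finite B" by (auto simp: A_def B_def prime_block_def)
  have "(\<Sum>p\<in>A. 1 / real (p * ord p (2::nat))) \<le> real (card A) * (1 / 8 ^ j)"
  proof (rule sum_bounded_above)
    fix p assume "p \<in> A"
    then have "8 ^ j * 1 \<le> p * ord p (2::nat)" unfolding A_def prime_block_def by (intro mult_mono) auto
    then have "real (8 ^ j) \<le> real (p * ord p (2::nat))" by (simp only: of_nat_le_iff mult_1_right)
    then show "1 / real (p * ord p (2::nat)) \<le> 1 / 8 ^ j"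
      using frac_le[of 1 1 "8 ^ j" "real (p * ord p (2::nat))"] by simp
  qed
  also have "\<dots> \<le> real (2 ^ j * 2 ^ j) * (1 / 8 ^ j)"
  proof (intro mult_right_mono of_nat_mono)
    have "card A \<le> card {p. prime p \<and> ord p (2::nat) \<in> {1..2 ^ j}}"
      by (intro card_mono card_primes_ord_le) (auto simp: A_def prime_block_def)
    then show "card A \<le> 2 ^ j * 2 ^ j" using card_primes_ord_le(2) le_trans by blast
  qed simp
  also have "\<dots> = (1 / 2) ^ j"
    by (simp add: power_divide field_simps flip: power_mult_distrib)
  finally have A: "(\<Sum>p\<in>A. 1 / real (p * ord p (2::nat))) \<le> (1 / 2) ^ j" .
  have "(\<Sum>p\<in>B. 1 / real (p * ord p (2::nat))) \<le> real (card B) * (1 / (8 ^ j * 2 ^ j))"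
  proof (rule sum_bounded_above)
    fix p assume "p \<in> B"
    then have "8 ^ j * 2 ^ j \<le> p * ord p (2::nat)" unfolding B_def prime_block_def by (intro mult_mono) auto
    then have "real (8 ^ j * 2 ^ j) \<le> real (p * ord p (2::nat))" by (simp only: of_nat_le_iff)
    then show "1 / real (p * ord p (2::nat)) \<le> 1 / (8 ^ j * 2 ^ j)"
      using frac_le[of 1 1 "8 ^ j * 2 ^ j" "real (p * ord p (2::nat))"] by simp
  qed
  also have "\<dots> \<le> real (7 * 8 ^ j) * (1 / (8 ^ j * 2 ^ j))"
  proof (intro mult_right_mono of_nat_mono)
    have "card B \<le> card {8 ^ j<..8 ^ Suc j :: nat}"
      by (intro card_mono) (auto simp: B_def prime_block_def)
    then show "card B \<le> 7 * 8 ^ j" by simp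
  qed simp
  also have "\<dots> = 7 * (1 / 2) ^ j" by (simp add: power_divide)
  finally have B: "(\<Sum>p\<in>B. 1 / real (p * ord p (2::nat))) \<le> 7 * (1 / 2) ^ j" .
  have "prime_block j = A \<union> B" "A \<inter> B = {}" by (auto simp: A_def B_def)
  then show ?thesis using A B fin by (simp add: sum.union_disjoint)
qed

lemma card_multiples_le: "card {m \<in> {1..x}. d dvd m} \<le> x div d"
proof (cases "d = 0")
  case False
  have "{m \<in> {1..x}. d dvd m} \<subseteq> (*) d ` {1..x div d}"
  proof safe
    fix m assume m: "m \<in> {1..x}" "d dvd m"
    then have "m div d \<le> x div d" "m = d * (m div d)" by (auto intro: div_le_mono)
    moreover from this have "m div d \<ge> 1" using m by (cases "m div d = 0") auto
    ultimately show "m \<in> (*) d ` {1..x div d}" by (metis atLeastAtMost_iff imageI)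
  qed
  then have "card {m \<in> {1..x}. d dvd m} \<le> card ((*) d ` {1..x div d})" by (intro card_mono) auto
  also have "\<dots> \<le> x div d" using card_image_le[of "{1..x div d}" "(*) d"] by simp
  finally show ?thesis .
qed auto

lemma sum_geometric_le:
  fixes q :: real
  assumes "0 \<le> q" "q < 1"
  shows "(\<Sum>j\<in>{i..<k}. q ^ j) \<le> q ^ i / (1 - q)"
proof (cases "i \<le> k")
  case True
  then have "(1 - q) * (\<Sum>j\<in>{i..<k}. q ^ j) = q ^ i - q ^ k"
    by (induction k rule: dec_induct) (simp_all add: distrib_left, simp add: algebra_simps)
  also have "\<dots> \<le> q ^ i" using assms by simp
  finally show ?thesis using assms by (simp add: field_simps)
qed (use assms in auto)

text \<open>Requiring \<open>m > 0\<close> also rules out \<open>p = 2\<close> as a witness, since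
  \<open>2 * ord 2 2 = 0\<close> divides only 0.\<close>

definition ord_multiples :: "nat \<Rightarrow> nat set" where
  "ord_multiples y = {m. m > 0 \<and> (\<exists>p. prime p \<and> p > y \<and> p * ord p (2::nat) dvd m)}"

lemma prime_block_cover:
  assumes p: "p > 8 ^ i" "p \<le> 8 ^ k"
  shows "\<exists>j\<in>{i..<k}. p \<in> {8 ^ j<..8 ^ Suc j :: nat}"
  using p
proof (induction k)
  case 0
  have "8 ^ i \<ge> (1::nat)" by simp
  then have False using 0 unfolding power_0 by linarith
  then show ?case ..
next
  case (Suc k)
  show ?case
  proof (cases "p \<le> 8 ^ k")
    case True
    then show ?thesis using Suc by fastforce
  next
    case False
    have "i < Suc k"
      using Suc.prems power_strict_increasing_iff[of 8 i "Suc k"] by (metis le_less_trans less_le_trans one_less_numeral_iff semiring_norm(76) power_less_imp_less_exp)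
    then show ?thesis using False Suc.prems by (intro bexI[of _ k]) auto
  qed
qed

text \<open>A union bound over the primes above \<open>8 ^ i\<close>, grouped into blocks. Relevant
  primes satisfy \<open>p \<le> m \<le> x \<le> 8 ^ x\<close>, so blocks with \<open>j < x\<close>
  suffice, and the geometric series doubles the constant 8.\<close>

lemma card_ord_multiples_le:
  "real (card (ord_multiples (8 ^ i) \<inter> {1..x})) \<le> 16 * real x * (1 / 2) ^ i"
proof -
  let ?M = "\<lambda>p. {m \<in> {1..x}. p * ord p (2::nat) dvd m}"
  have "ord_multiples (8 ^ i) \<inter> {1..x} \<subseteq> (\<Union>j\<in>{i..<x}. \<Union>p\<in>prime_block j. ?M p)"
  proof
    fix m assume m: "m \<in> ord_multiples (8 ^ i) \<inter> {1..x}"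
    then obtain p where p: "prime p" "p > 8 ^ i" "p * ord p (2::nat) dvd m" by (auto simp: ord_multiples_def)
    have "p \<le> m" using p(3) m by (metis Int_iff atLeastAtMost_iff dvd_imp_le dvd_mult_left less_le_trans zero_less_one)
    also have "m \<le> x" using m by simp
    also have "x \<le> 8 ^ x" using less_exp[of x] power_mono[of 2 "8::nat" x] by linarith
    finally obtain j where j: "j \<in> {i..<x}" "p \<in> {8 ^ j<..8 ^ Suc j}" using prime_block_cover p by blast
    have "ord p (2::nat) \<noteq> 0" using p(3) m by (intro notI) auto
    then have "p \<in> prime_block j" using p j unfolding prime_block_def by (simp add: Suc_le_eq)
    then show "m \<in> (\<Union>j\<in>{i..<x}. \<Union>p\<in>prime_block j. ?M p)" using j m p by blast
  qed
  moreover have fin: "finite (prime_block j)" for j unfolding prime_block_def by auto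
  ultimately have "card (ord_multiples (8 ^ i) \<inter> {1..x}) \<le> card (\<Union>j\<in>{i..<x}. \<Union>p\<in>prime_block j. ?M p)"
    by (intro card_mono) auto
  also have "\<dots> \<le> (\<Sum>j\<in>{i..<x}. card (\<Union>p\<in>prime_block j. ?M p))" by (rule card_UN_le) simp
  also have "\<dots> \<le> (\<Sum>j\<in>{i..<x}. \<Sum>p\<in>prime_block j. card (?M p))"
    by (intro sum_mono card_UN_le fin)
  finally have "real (card (ord_multiples (8 ^ i) \<inter> {1..x}))
      \<le> real (\<Sum>j\<in>{i..<x}. \<Sum>p\<in>prime_block j. card (?M p))"
    by (simp only: of_nat_le_iff)
  also have "\<dots> = (\<Sum>j\<in>{i..<x}. \<Sum>p\<in>prime_block j. real (card (?M p)))" by simp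
  also have "\<dots> \<le> (\<Sum>j\<in>{i..<x}. \<Sum>p\<in>prime_block j. real x * (1 / real (p * ord p (2::nat))))"
  proof (intro sum_mono)
    fix p
    have "real (card (?M p)) \<le> real (x div (p * ord p (2::nat)))"
      using card_multiples_le by (simp only: of_nat_le_iff)
    also have "\<dots> \<le> real x / real (p * ord p (2::nat))" by (rule of_nat_div_le_of_nat)
    finally show "real (card (?M p)) \<le> real x * (1 / real (p * ord p (2::nat)))" by simp
  qed
  also have "\<dots> \<le> (\<Sum>j\<in>{i..<x}. real x * (8 * (1 / 2) ^ j))"
    by (intro sum_mono, subst sum_distrib_left[symmetric], intro mult_left_mono sum_prime_block_le) auto
  also have "\<dots> = 8 * real x * (\<Sum>j\<in>{i..<x}. (1 / 2) ^ j)" by (simp add: sum_distrib_left mult_ac)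
  also have "\<dots> \<le> 8 * real x * ((1 / 2) ^ i / (1 - 1 / 2))"
    by (intro mult_left_mono sum_geometric_le) auto
  finally show ?thesis by simp
qed

section \<open>Density of exceptional windows and of smooth numbers\<close>

text \<open>Markov's inequality.\<close>
lemma card_windows_le:
  fixes A :: "nat set"
  shows "k * card {n \<in> {1..x}. k \<le> card (A \<inter> {n<..n + R})} \<le> R * card (A \<inter> {1..x + R})"
proof -
  let ?B = "{n \<in> {1..x}. k \<le> card (A \<inter> {n<..n + R})}" and ?C = "A \<inter> {1..x + R}"
  have "k * card ?B = (\<Sum>n\<in>?B. k)" by simp
  also have "\<dots> \<le> (\<Sum>n\<in>?B. card (A \<inter> {n<..n + R}))" by (intro sum_mono) auto
  also have "\<dots> = (\<Sum>n\<in>?B. \<Sum>m\<in>?C. if m \<in> {n<..n + R} then 1 else 0)"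
    by (intro sum.cong refl) (auto simp: sum.If_cases intro!: arg_cong[of _ _ card])
  also have "\<dots> = (\<Sum>m\<in>?C. \<Sum>n\<in>?B. if m \<in> {n<..n + R} then 1 else 0)" by (rule sum.swap)
  also have "\<dots> \<le> (\<Sum>m\<in>?C. R)"
  proof (intro sum_mono)
    fix m
    have "(\<Sum>n\<in>?B. if m \<in> {n<..n + R} then 1 else 0) = card (?B \<inter> {n. m \<in> {n<..n + R}})"
      by (simp add: sum.If_cases)
    also have "\<dots> \<le> card {m - R..<m}" by (intro card_mono) auto
    also have "\<dots> \<le> R" by simp
    finally show "(\<Sum>n\<in>?B. if m \<in> {n<..n + R} then 1 else 0) \<le> R" .
  qed
  finally show ?thesis by (simp add: mult.commute)
qed

text \<open>
  The threshold \<open>6\<^sup>i\<close> balances two demands: the window has at least \<open>6\<^sup>i\<close> elements with large prime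
  factors, and \<open>8\<^sup>i * 2\<^sup>-\<^sup>i / 6\<^sup>i = (2/3)\<^sup>i\<close> is summable.
\<close>
definition bad_windows :: "nat \<Rightarrow> nat set" where
  "bad_windows i = {n. 6 ^ i \<le> card (ord_multiples (8 ^ i) \<inter> {n<..n + 8 ^ Suc i})}"

text \<open>The constant is 8 * 16 * 9: the window length is 8 * 8^i, 16 comes from
  \<open>card_ord_multiples_le\<close>, and \<open>8 ^ i \<le> x\<close> bounds
  \<open>x + 8 ^ Suc i\<close> by 9x.\<close>

lemma card_bad_windows_le:
  assumes "8 ^ i \<le> x"
  shows "real (card (bad_windows i \<inter> {1..x})) \<le> 1152 * real x * (2 / 3) ^ i"
proof -
  let ?E = "ord_multiples (8 ^ i)" and ?R = "8 ^ Suc i :: nat"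
  have x: "8 ^ i \<le> real x" using assms by (metis of_nat_le_iff of_nat_numeral of_nat_power)
  have "bad_windows i \<inter> {1..x} = {n \<in> {1..x}. 6 ^ i \<le> card (?E \<inter> {n<..n + ?R})}"
    by (auto simp: bad_windows_def)
  then have "6 ^ i * card (bad_windows i \<inter> {1..x}) \<le> ?R * card (?E \<inter> {1..x + ?R})"
    using card_windows_le by presburger
  then have "real (6 ^ i * card (bad_windows i \<inter> {1..x})) \<le> real (?R * card (?E \<inter> {1..x + ?R}))"
    by (simp only: of_nat_le_iff)
  also have "\<dots> = 8 * 8 ^ i * real (card (?E \<inter> {1..x + ?R}))" by simp
  also have "\<dots> \<le> 8 * 8 ^ i * (16 * real (x + ?R) * (1 / 2) ^ i)"
    by (intro mult_left_mono card_ord_multiples_le) auto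
  also have "\<dots> \<le> 8 * 8 ^ i * (16 * (9 * real x) * (1 / 2) ^ i)"
    using x by (intro mult_left_mono mult_right_mono) auto
  also have "\<dots> = 6 ^ i * (1152 * real x * (2 / 3) ^ i)"
  proof -
    have "(8::real) ^ i * (1 / 2) ^ i = 6 ^ i * (2 / 3) ^ i" by (simp flip: power_mult_distrib)
    then show ?thesis by (simp add: mult_ac)
  qed
  finally show ?thesis by simp
qed

text \<open>Write m = u v^2 with u squarefree. For smooth m, u is a product of distinct primes up to
  \<open>y\<close>, hence divides \<open>fact y\<close>, and v is at most the square root of
  \<open>x\<close>.\<close>

lemma card_smooth_le:
  "real (card {m \<in> {1..x}. \<forall>p. prime p \<longrightarrow> p dvd m \<longrightarrow> p \<le> y}) \<le> fact y * sqrt (real x)"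
proof -
  let ?A = "{m \<in> {1..x}. \<forall>p. prime p \<longrightarrow> p dvd m \<longrightarrow> p \<le> y}" and ?s = "nat \<lfloor>sqrt (real x)\<rfloor>"
  let ?f = "\<lambda>m::nat. (squarefree_part m, square_part m)"
  have "inj_on ?f ?A"
    by (rule inj_onI) (metis Pair_inject squarefree_decompose)
  moreover have "?f ` ?A \<subseteq> {1..fact y} \<times> {1..?s}"
  proof (rule image_subsetI)
    fix m assume m: "m \<in> ?A"
    let ?u = "squarefree_part m" and ?v = "square_part m"
    have dec: "m = ?u * ?v ^ 2" by (rule squarefree_decompose)
    have u0: "?u > 0" by (metis neq0_conv squarefree_part_nonzero)
    then have "?u = (\<Prod>p\<in>prime_factors ?u. p ^ multiplicity p ?u)"
      by (rule prime_factorization_nat)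
    also have "\<dots> dvd fact y"
    proof (rule prod_prime_powers_dvd)
      fix p assume p: "p \<in> prime_factors ?u"
      then have "p dvd m" using dec by (metis dvd_mult2 in_prime_factors_imp_dvd)
      moreover have "prime p" using p by blast
      ultimately have "p dvd fact y" using m by (auto simp: prime_dvd_fact_iff)
      moreover have "p ^ multiplicity p ?u dvd p ^ 1"
        using p by (intro le_imp_power_dvd) (auto intro: prime_multiplicity_squarefree_part_le_Suc_0)
      ultimately show "p ^ multiplicity p ?u dvd fact y" by (metis dvd_trans power_one_right)
    qed auto
    finally have u: "?u \<le> fact y" by (rule dvd_imp_le) simp
    have "?v ^ 2 \<le> m" using m by (intro dvd_imp_le) auto
    then have "real (?v ^ 2) \<le> real x" using m by (simp only: of_nat_le_iff) auto
    then have "real ?v \<le> sqrt (real x)" by (intro real_le_rsqrt) simp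
    then have "?v \<le> ?s" by (simp add: le_nat_floor)
    moreover have "?u \<ge> 1" using u0 by simp
    moreover have "?v > 0" using m by (auto intro!: Nat.gr0I)
    ultimately show "?f m \<in> {1..fact y} \<times> {1..?s}" using u by (simp add: Suc_le_eq)
  qed
  ultimately have "card ?A \<le> card ({1..fact y :: nat} \<times> {1..?s})"
    by (intro card_inj_on_le) auto
  then have "real (card ?A) \<le> real (fact y * ?s)" by (simp only: of_nat_le_iff) (simp add: card_cartesian_product)
  also have "\<dots> \<le> fact y * sqrt (real x)" by (simp add: mult_left_mono)
  finally show ?thesis .
qed

section \<open>Density of the integral set\<close>

lemma integral_set_cover:
  "\<exists>i1. \<forall>i0\<ge>i1. \<exists>n0. \<forall>n\<in>integral_set. n0 \<le> n \<longrightarrow>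
     (\<forall>p. prime p \<longrightarrow> p dvd Suc n \<longrightarrow> p \<le> 8 ^ i0) \<or> Suc n \<in> ord_multiples (8 ^ i0) \<or>
     (\<exists>i\<ge>i0. 8 ^ i \<le> n \<and> n \<in> bad_windows i)"
proof -
  obtain i1 where i1: "\<And>i a b. i1 \<le> i \<Longrightarrow> 8 ^ i \<le> a \<Longrightarrow> 2 * a \<le> b \<Longrightarrow>
      6 ^ i \<le> card (large_prime_multiples a b)"
    using card_large_prime_multiples_ge by blast
  obtain a0 where a0: "\<And>a b. a0 \<le> a \<Longrightarrow> a \<le> b \<Longrightarrow> b < 2 * a \<Longrightarrow> large_prime_multiples a b \<noteq> {}"
    using large_prime_multiples_nonempty by blast
  show ?thesis
  proof (intro exI allI impI ballI)
    fix i0 n assume i0: "max 1 i1 \<le> i0" and n: "n \<in> integral_set" and n0: "2 * a0 + 8 ^ i1 \<le> n"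
    obtain r where r: "r \<ge> 1" "S r n \<in> \<int>" using n by (auto simp: integral_set_def)
    \<comment> \<open>For \<open>r > n\<close> the roles are exchanged: the interval
      \<open>{r<..r + n}\<close> of length \<open>n\<close> contains a multiple of a prime above
      \<open>n\<close>, contradicting \<open>S_not_int\<close>.\<close>
    have "r \<le> n"
    proof (rule ccontr)
      assume "\<not> r \<le> n"
      moreover have "large_prime_multiples n r \<noteq> {}" if "2 * n \<le> r"
      proof
        assume "large_prime_multiples n r = {}"
        then show False using i1[of i1 n r] n0 that by simp
      qed
      ultimately have "large_prime_multiples n r \<noteq> {}" using a0[of n r] n0 by linarith
      then obtain m p where "prime p" "p > n" "m \<in> {r<..r + n}" "p dvd m"
        by (auto simp: large_prime_multiples_def)
      then show False using S_not_int r by blast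
    qed
    have ord_dvd: "p * ord p (2::nat) dvd m" if "prime p" "p > r" "m \<in> {n<..n + r}" "p dvd m" for p m
      using that r by (intro prime_times_ord_dvd dvd_two_power_if_S_int) auto
    show "(\<forall>p. prime p \<longrightarrow> p dvd Suc n \<longrightarrow> p \<le> 8 ^ i0) \<or> Suc n \<in> ord_multiples (8 ^ i0) \<or>
     (\<exists>i\<ge>i0. 8 ^ i \<le> n \<and> n \<in> bad_windows i)"
    proof (cases "r < 8 ^ i0")
      case True
      \<comment> \<open>A prime above \<open>8 ^ i0\<close> also exceeds \<open>r\<close>, so a
        single element of the interval, \<open>Suc n\<close>, settles all bounded \<open>r\<close>
        at once.\<close>
      have "Suc n \<in> ord_multiples (8 ^ i0)" if "prime p" "p dvd Suc n" "8 ^ i0 < p" for p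
        unfolding ord_multiples_def using that r True ord_dvd[of p "Suc n"] by auto
      then show ?thesis using not_le by blast
    next
      case False
      \<comment> \<open>The blocks are open on the left, so \<open>prime_block_cover\<close> is
        applied to \<open>Suc r\<close> to obtain \<open>8 ^ i \<le> r\<close>.\<close>
      have "Suc r \<le> 8 ^ Suc r"
        by (rule order.trans[OF less_imp_le[OF less_exp] power_mono]) auto
      moreover have "8 ^ i0 < Suc r" using False by simp
      ultimately obtain i where "i \<in> {i0..<Suc r}" "Suc r \<in> {8 ^ i<..8 ^ Suc i}"
        using prime_block_cover by blast
      then have i: "i0 \<le> i" "8 ^ i \<le> r" "r \<le> 8 ^ Suc i" by auto
      show ?thesis
      proof (cases "2 * r \<le> n")
        case True
        \<comment> \<open>Enlarging the window from \<open>r\<close> to \<open>8 ^ Suc i\<close>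
          makes the exceptional set depend on the scale \<open>i\<close> alone, so there is no union
          over \<open>r\<close>.\<close>
        have "large_prime_multiples r n \<subseteq> ord_multiples (8 ^ i) \<inter> {n<..n + 8 ^ Suc i}"
        proof
          fix m assume "m \<in> large_prime_multiples r n"
          then obtain p where p: "prime p" "p > r" "m \<in> {n<..n + r}" "p dvd m"
            by (auto simp: large_prime_multiples_def)
          then have "p * ord p (2::nat) dvd m" "p > 8 ^ i" using ord_dvd i by auto
          then show "m \<in> ord_multiples (8 ^ i) \<inter> {n<..n + 8 ^ Suc i}"
            unfolding ord_multiples_def using p i by auto
        qed
        then have "card (large_prime_multiples r n) \<le> card (ord_multiples (8 ^ i) \<inter> {n<..n + 8 ^ Suc i})"
          by (intro card_mono) auto
        moreover have "6 ^ i \<le> card (large_prime_multiples r n)"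
          using i1[of i r n] i i0 True by simp
        ultimately have "n \<in> bad_windows i" unfolding bad_windows_def by simp
        then show ?thesis using i \<open>r \<le> n\<close> le_trans by blast
      next
        case False
        then have "large_prime_multiples r n \<noteq> {}" using a0[of r n] n0 \<open>r \<le> n\<close> by linarith
        then obtain p m where p: "prime p" "p > r" and m: "m \<in> {n<..n + r}" "p dvd m"
          by (auto simp: large_prime_multiples_def)
        let ?d = "ord p (2::nat)"
        have "m > 0" using m by simp
        have dvd: "p * ?d dvd m" using ord_dvd p m by blast
        then have "?d \<noteq> 0" using \<open>m > 0\<close> by (intro notI) simp
        have "p * ?d \<le> m" using dvd \<open>m > 0\<close> by (rule dvd_imp_le)
        \<comment> \<open>From n < 2r follows m <= n + r < 3r < 3p, so the order is 1 or 2 and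
          \<open>p\<close> divides 1 or 3. This contradicts
          \<open>p > r \<ge> 8 ^ i \<ge> 8\<close>, where \<open>i0 \<ge> 1\<close> enters.\<close>
        also have "m < p * 3" using m False p by auto
        finally have "?d < 3" by simp
        then have "?d = 1 \<or> ?d = 2" using \<open>?d \<noteq> 0\<close> by linarith
        moreover have "[2 ^ ?d = 1] (mod p)" by (rule ord)
        ultimately have "p dvd 1 \<or> p dvd 3" by (elim disjE) (auto simp: cong_altdef_nat)
        then have "p \<le> 3" using dvd_imp_le[of p 1] dvd_imp_le[of p 3] by auto
        moreover have "(8::nat) ^ 1 \<le> 8 ^ i" using i i0 by (intro power_increasing) auto
        ultimately show ?thesis using p i by simp
      qed
    qed
  qed
qed

lemma card_Suc_image_le: "card {n \<in> {1..x}. Suc n \<in> A} \<le> card (A \<inter> {1..Suc x})"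
  by (rule card_inj_on_le[of Suc]) auto

text \<open>\<open>C\<close> and \<open>D\<close> may depend on \<open>i\<close>, so
  \<open>x\<close> can tend to infinity before \<open>i\<close> does. The constant is 3472 = 16 + 3
  * 1152, the 3 coming from the geometric series of ratio 2/3.\<close>

lemma card_integral_set_le:
  "\<exists>i1. \<forall>i\<ge>i1. \<exists>C D. \<forall>x. real (card (integral_set \<inter> {1..x}))
     \<le> C + D * sqrt (real x + 1) + 3472 * (2 / 3) ^ i * (real x + 1)"
proof -
  obtain i1 where i1: "\<And>i0. i1 \<le> i0 \<Longrightarrow> \<exists>n0. \<forall>n\<in>integral_set. n0 \<le> n \<longrightarrow>
     (\<forall>p. prime p \<longrightarrow> p dvd Suc n \<longrightarrow> p \<le> 8 ^ i0) \<or> Suc n \<in> ord_multiples (8 ^ i0) \<or>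
     (\<exists>i\<ge>i0. 8 ^ i \<le> n \<and> n \<in> bad_windows i)"
    using integral_set_cover by blast
  show ?thesis
  proof (rule exI[of _ i1], intro allI impI)
    fix i0 assume "i1 \<le> i0"
    then obtain n0 where n0: "\<And>n. n \<in> integral_set \<Longrightarrow> n0 \<le> n \<Longrightarrow>
     (\<forall>p. prime p \<longrightarrow> p dvd Suc n \<longrightarrow> p \<le> 8 ^ i0) \<or> Suc n \<in> ord_multiples (8 ^ i0) \<or>
     (\<exists>i\<ge>i0. 8 ^ i \<le> n \<and> n \<in> bad_windows i)"
      using i1 by blast
    show "\<exists>C D. \<forall>x. real (card (integral_set \<inter> {1..x}))
       \<le> C + D * sqrt (real x + 1) + 3472 * (2 / 3) ^ i0 * (real x + 1)"
    proof (intro exI allI)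
      fix x
      let ?P = "{m. \<forall>p. prime p \<longrightarrow> p dvd m \<longrightarrow> p \<le> 8 ^ i0}"
      let ?A = "{n \<in> {1..x}. Suc n \<in> ?P}"
      let ?B = "{n \<in> {1..x}. Suc n \<in> ord_multiples (8 ^ i0)}"
      \<comment> \<open>Since \<open>i < 8 ^ i \<le> n \<le> x\<close>, finitely many scales matter,
        and \<open>8 ^ i \<le> x\<close> is what \<open>card_bad_windows_le\<close>
        requires.\<close>
      define I where "I = {i \<in> {i0..<x}. 8 ^ i \<le> x}"
      let ?D = "\<Union>i\<in>I. bad_windows i \<inter> {1..x}"
      have "integral_set \<inter> {1..x} \<subseteq> {..<n0} \<union> (?A \<union> (?B \<union> ?D))"
      proof
        fix n assume n: "n \<in> integral_set \<inter> {1..x}"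
        have "n \<in> ?D" if i: "i \<ge> i0" "8 ^ i \<le> n" "n \<in> bad_windows i" for i
        proof -
          have "i < 8 ^ i" by (rule less_le_trans[OF less_exp power_mono]) auto
          then have "i \<in> I" using i n unfolding I_def by auto
          then show ?thesis using i n by blast
        qed
        then show "n \<in> {..<n0} \<union> (?A \<union> (?B \<union> ?D))"
          using n0[of n] n by (cases "n < n0") (simp, auto)
      qed
      then have "card (integral_set \<inter> {1..x}) \<le> card ({..<n0} \<union> (?A \<union> (?B \<union> ?D)))"
        by (intro card_mono) (auto simp: I_def)
      also have "\<dots> \<le> n0 + (card ?A + (card ?B + card ?D))"
        using card_Un_le[of "{..<n0}" "?A \<union> (?B \<union> ?D)"] card_Un_le[of ?A "?B \<union> ?D"] card_Un_le[of ?B ?D]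
        unfolding card_lessThan by linarith
      finally have "real (card (integral_set \<inter> {1..x})) \<le> real (n0 + (card ?A + (card ?B + card ?D)))"
        by (simp only: of_nat_le_iff)
      also have "\<dots> = real n0 + (real (card ?A) + (real (card ?B) + real (card ?D)))" by simp
      also have "real (card ?A) \<le> fact (8 ^ i0) * sqrt (real x + 1)"
      proof -
        have "?P \<inter> {1..Suc x} = {m \<in> {1..Suc x}. \<forall>p. prime p \<longrightarrow> p dvd m \<longrightarrow> p \<le> 8 ^ i0}" by auto
        then have "real (card ?A) \<le> real (card {m \<in> {1..Suc x}. \<forall>p. prime p \<longrightarrow> p dvd m \<longrightarrow> p \<le> 8 ^ i0})"
          using card_Suc_image_le[of x ?P] by (simp only: of_nat_le_iff)
        also have "\<dots> \<le> fact (8 ^ i0) * sqrt (real (Suc x))" by (rule card_smooth_le)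
        finally show ?thesis by (simp add: add.commute)
      qed
      also have "real (card ?B) \<le> 16 * (2 / 3) ^ i0 * (real x + 1)"
      proof -
        have "real (card ?B) \<le> real (card (ord_multiples (8 ^ i0) \<inter> {1..Suc x}))"
          using card_Suc_image_le by (simp only: of_nat_le_iff)
        also have "\<dots> \<le> 16 * real (Suc x) * (1 / 2) ^ i0" by (rule card_ord_multiples_le)
        also have "\<dots> \<le> 16 * real (Suc x) * (2 / 3) ^ i0" by (intro mult_left_mono power_mono) auto
        finally show ?thesis by (simp add: algebra_simps)
      qed
      also have "real (card ?D) \<le> 3456 * (2 / 3) ^ i0 * (real x + 1)"
      proof -
        have "card ?D \<le> (\<Sum>i\<in>I. card (bad_windows i \<inter> {1..x}))"
          by (rule card_UN_le) (simp add: I_def)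
        then have "real (card ?D) \<le> real (\<Sum>i\<in>I. card (bad_windows i \<inter> {1..x}))"
          by (simp only: of_nat_le_iff)
        also have "\<dots> = (\<Sum>i\<in>I. real (card (bad_windows i \<inter> {1..x})))" by simp
        also have "\<dots> \<le> (\<Sum>i\<in>I. 1152 * real x * (2 / 3) ^ i)"
          by (intro sum_mono card_bad_windows_le) (simp add: I_def)
        also have "\<dots> \<le> (\<Sum>i\<in>{i0..<x}. 1152 * real x * (2 / 3) ^ i)"
          by (rule sum_mono2) (auto simp: I_def)
        also have "\<dots> = 1152 * real x * (\<Sum>i\<in>{i0..<x}. (2 / 3) ^ i)" by (simp add: sum_distrib_left)
        also have "\<dots> \<le> 1152 * real x * ((2 / 3) ^ i0 / (1 - 2 / 3))"
          by (intro mult_left_mono sum_geometric_le) auto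
        also have "\<dots> \<le> 3456 * (2 / 3) ^ i0 * (real x + 1)" by (simp add: algebra_simps)
        finally show ?thesis .
      qed
      finally show "real (card (integral_set \<inter> {1..x}))
         \<le> real n0 + fact (8 ^ i0) * sqrt (real x + 1) + 3472 * (2 / 3) ^ i0 * (real x + 1)"
        by (simp add: algebra_simps)
    qed
  qed
qed

theorem theorem1:
  shows "((\<lambda>x::real. real (card {n \<in> integral_set. real n \<in> {1..x}}) / x) \<longlongrightarrow> 0) at_top"
proof (rule tendstoI)
  fix e :: real assume e: "e > 0"
  obtain i1 where i1: "\<And>i. i1 \<le> i \<Longrightarrow> \<exists>C D. \<forall>x. real (card (integral_set \<inter> {1..x}))
     \<le> C + D * sqrt (real x + 1) + 3472 * (2 / 3) ^ i * (real x + 1)"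
    using card_integral_set_le by blast
  have "(\<lambda>i. 3472 * (2 / 3) ^ i :: real) \<longlonglongrightarrow> 0" by real_asymp
  then have "\<forall>\<^sub>F i in sequentially. 3472 * (2 / 3) ^ i < e" using e by (rule order_tendstoD)
  with eventually_ge_at_top[of i1]
  have "\<forall>\<^sub>F i in sequentially. i1 \<le> i \<and> 3472 * (2 / 3) ^ i < e" by (rule eventually_conj)
  then obtain i where i: "i1 \<le> i" "3472 * (2 / 3) ^ i < e"
    using eventually_happens'[OF sequentially_bot] by blast
  define c where "c = 3472 * (2 / 3 :: real) ^ i"
  obtain C D where CD: "\<And>x. real (card (integral_set \<inter> {1..x})) \<le> C + D * sqrt (real x + 1) + c * (real x + 1)"
    using i1[OF i(1)] unfolding c_def by blast
  \<comment> \<open>The sign of \<open>D\<close> is unknown; its absolute value makes the bound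
    monotone when the floor of \<open>x\<close> is replaced by \<open>x\<close>.\<close>
  define D' where "D' = \<bar>D\<bar>"
  have "((\<lambda>x::real. (C + D' * sqrt (x + 1) + c * (x + 1)) / x) \<longlongrightarrow> c) at_top"
    by real_asymp
  then have "\<forall>\<^sub>F x in at_top. (C + D' * sqrt (x + 1) + c * (x + 1)) / x < e"
    using i(2) unfolding c_def by (rule order_tendstoD)
  then show "\<forall>\<^sub>F x in at_top. dist (real (card {n \<in> integral_set. real n \<in> {1..x}}) / x) 0 < e"
    using eventually_gt_at_top[of 0]
  proof eventually_elim
    case (elim x)
    let ?X = "nat \<lfloor>x\<rfloor>"
    have X: "real ?X \<le> x" using elim by simp
    have "{n \<in> integral_set. real n \<in> {1..x}} = integral_set \<inter> {1..?X}"
      using elim by (auto simp: le_nat_floor integral_set_def) linarith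
    then have "real (card {n \<in> integral_set. real n \<in> {1..x}}) \<le> C + D * sqrt (real ?X + 1) + c * (real ?X + 1)"
      using CD by simp
    also have "\<dots> \<le> C + D' * sqrt (x + 1) + c * (x + 1)"
      using X by (intro add_mono mult_mono) (auto simp: D'_def c_def)
    finally have "real (card {n \<in> integral_set. real n \<in> {1..x}}) / x \<le> (C + D' * sqrt (x + 1) + c * (x + 1)) / x"
      using elim by (intro divide_right_mono) auto
    then show ?case using elim by simp
  qed
qed

end
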